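(* Let $(M,\phi,\xi,\eta,g)$ be a $(2n+1)$-dimensional Kenmotsu manifold, let $a>0$ be a constant, and let $(\overline{\phi},\overline{\xi},\overline{\eta},\overline{g})$ be the $D$-homothetically deformed structure on $M$. If $(V,\overline{\lambda})$ defines an almost Ricci soliton in $(M,\overline{g})$ with $V$ solenoidal, then $$\overline{\lambda}=\xi(\eta(V))-\frac{2n}{a^2},$$ for all vector fields $X,Y$ on $M$ $$\begin{aligned}\mathrm{Ric}(X,Y)={}&[a\,\xi(\eta(V))-2n]\,g(X,Y)+a(a-1)\,\xi(\eta(V))\,\eta(X)\eta(Y)-\frac{a}{2}[g(\nabla_XV,Y)+g(\nabla_YV,X)]\\&-\frac{a(a-1)}{2}\{\eta(X)[\eta(\nabla_YV)+g(Y,V)]+\eta(Y)[\eta(\nabla_XV)+g(X,V)]-2\eta(X)\eta(Y)\eta(V)\},\end{aligned}$$ and $$\mathrm{scal}=(2n+1)[a\,\xi(\eta(V))-2n],$$ where $\nabla$, $\mathrm{Ric}$ and $\mathrm{scal}$ are the Levi-Civita connection, the Ricci tensor and the scalar curvature of $g$.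
   Context: An almost contact metric manifold $(M,\phi,\xi,\eta,g)$ is an odd-dimensional Riemannian manifold $(M,g)$, here of dimension $2n+1$ with $n\ge 1$, together with a $(1,1)$-tensor field $\phi$, a vector field $\xi$ (the Reeb vector field) and a $1$-form $\eta$ such that $\phi^2=-I+\eta\otimes\xi$, $\eta(\xi)=1$, $\eta=g(\xi,\cdot)$ and $g(\phi X,\phi Y)=g(X,Y)-\eta(X)\eta(Y)$. It is a Kenmotsu manifold if the Levi-Civita connection $\nabla$ of $g$ satisfies $(\nabla_X\phi)Y=g(\phi X,Y)\xi-\eta(Y)\phi X$ for all vector fields $X,Y$. For a constant $a>0$, the $D$-homothetically deformed structure is $\overline{\phi}=\phi$, $\overline{\xi}=\frac{1}{a}\xi$, $\overline{\eta}=a\eta$, $\overline{g}=ag+a(a-1)\eta\otimes\eta$. For a Riemannian metric $h$, a nowhere-vanishing vector field $V$ and a smooth function $\lambda$ on $M$, the pair $(V,\lambda)$ defines an almost Ricci soliton in $(M,h)$ if $\frac12\mathcal{L}_Vh+\mathrm{Ric}_h=\lambda h$, where $\mathcal{L}$ is the Lie derivative and $\mathrm{Ric}_h$ the Ricci tensor of $h$. A vector field is solenoidal if it is divergence-free; the divergences with respect to $g$ and $\overline{g}$ coincide. *)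

theory Defs
  imports "HOL-Analysis.Analysis" "HOL-Library.Function_Algebras"
begin

section \<open>Smooth manifolds\<close>

text \<open>
  Used on open sets \<open>S\<close> only.  As the domain is finite-dimensional, \<open>Ck_on k S f\<close> is the usual
  notion of being \<open>k\<close> times continuously differentiable: all iterated directional derivatives up to
  order \<open>k\<close> exist and are continuous.
\<close>

primrec Ck_on :: "nat \<Rightarrow> 'e::euclidean_space set \<Rightarrow> ('e \<Rightarrow> 'f::real_normed_vector) \<Rightarrow> bool" where
  "Ck_on 0 S f \<longleftrightarrow> continuous_on S f"
| "Ck_on (Suc k) S f \<longleftrightarrow>
     f differentiable_on S \<and> (\<forall>v. Ck_on k S (\<lambda>x. frechet_derivative f (at x) v))"

definition smooth_on :: "'e::euclidean_space set \<Rightarrow> ('e \<Rightarrow> 'f::real_normed_vector) \<Rightarrow> bool" where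
  "smooth_on S f \<longleftrightarrow> (\<forall>k. Ck_on k S f)"

type_synonym ('a, 'e) chart = "'a set \<times> ('a \<Rightarrow> 'e)"

definition is_chart :: "('a::topological_space, 'e::euclidean_space) chart \<Rightarrow> bool" where
  "is_chart = (\<lambda>(U, \<psi>). open U \<and> open (\<psi> ` U) \<and> homeomorphism U (\<psi> ` U) \<psi> (inv_into U \<psi>))"

text \<open>
  The manifold is the whole (Hausdorff, second countable) type \<open>'a\<close>; its dimension is \<open>DIM('e)\<close>.
\<close>

definition smooth_atlas ::
  "('a::{t2_space, second_countable_topology}, 'e::euclidean_space) chart set \<Rightarrow> bool" where
  "smooth_atlas A \<longleftrightarrow>
     (\<forall>c\<in>A. is_chart c) \<and> (\<Union>c\<in>A. fst c) = UNIV \<and>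
     (\<forall>(U, \<psi>)\<in>A. \<forall>(W, \<psi>')\<in>A. smooth_on (\<psi> ` (U \<inter> W)) (\<psi>' \<circ> inv_into U \<psi>))"

definition smooth_funs :: "('a, 'e::euclidean_space) chart set \<Rightarrow> ('a \<Rightarrow> real) set" where
  "smooth_funs A = {f. \<forall>(U, \<psi>)\<in>A. smooth_on (\<psi> ` U) (f \<circ> inv_into U \<psi>)}"

section \<open>Vector fields and tensor fields\<close>

text \<open>
  Sums, differences and products of functions are taken pointwise (\<open>Function_Algebras\<close>).
  Vector fields are the derivations of the algebra of smooth functions.  A derivation is made total
  by sending functions that are not smooth to \<open>0\<close>, so that equality of vector fields is HOL equality.
\<close>

type_synonym 'a vfield = "('a \<Rightarrow> real) \<Rightarrow> 'a \<Rightarrow> real"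

definition vector_fields :: "('a, 'e::euclidean_space) chart set \<Rightarrow> 'a vfield set" where
  "vector_fields A = {X.
     (\<forall>f. f \<notin> smooth_funs A \<longrightarrow> X f = 0) \<and>
     (\<forall>f\<in>smooth_funs A. X f \<in> smooth_funs A) \<and>
     (\<forall>f\<in>smooth_funs A. \<forall>h\<in>smooth_funs A. X (f + h) = X f + X h) \<and>
     (\<forall>f\<in>smooth_funs A. \<forall>c. X ((\<lambda>_. c) * f) = (\<lambda>_. c) * X f) \<and>
     (\<forall>f\<in>smooth_funs A. \<forall>h\<in>smooth_funs A. X (f * h) = f * X h + h * X f)}"

definition vscale :: "('a \<Rightarrow> real) \<Rightarrow> 'a vfield \<Rightarrow> 'a vfield" (infixr "\<odot>" 72) where
  "f \<odot> X = (\<lambda>h. f * X h)"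

definition lie_bracket :: "'a vfield \<Rightarrow> 'a vfield \<Rightarrow> 'a vfield" where
  "lie_bracket X Y = (\<lambda>f. X (Y f) - Y (X f))"

definition vanishes_at :: "'a vfield \<Rightarrow> 'a \<Rightarrow> bool" where
  "vanishes_at X p \<longleftrightarrow> (\<forall>f. X f p = 0)"

text \<open>
  Tensor fields are maps on vector fields that are linear over the smooth functions in every slot.
  Their values on arguments that are not vector fields are irrelevant.
\<close>

definition one_form ::
  "('a, 'e::euclidean_space) chart set \<Rightarrow> ('a vfield \<Rightarrow> 'a \<Rightarrow> real) \<Rightarrow> bool" where
  "one_form A \<theta> \<longleftrightarrow>
     (\<forall>X\<in>vector_fields A. \<theta> X \<in> smooth_funs A) \<and>
     (\<forall>X\<in>vector_fields A. \<forall>Y\<in>vector_fields A. \<theta> (X + Y) = \<theta> X + \<theta> Y) \<and>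
     (\<forall>f\<in>smooth_funs A. \<forall>X\<in>vector_fields A. \<theta> (f \<odot> X) = f * \<theta> X)"

definition tensor_11 ::
  "('a, 'e::euclidean_space) chart set \<Rightarrow> ('a vfield \<Rightarrow> 'a vfield) \<Rightarrow> bool" where
  "tensor_11 A T \<longleftrightarrow>
     (\<forall>X\<in>vector_fields A. T X \<in> vector_fields A) \<and>
     (\<forall>X\<in>vector_fields A. \<forall>Y\<in>vector_fields A. T (X + Y) = T X + T Y) \<and>
     (\<forall>f\<in>smooth_funs A. \<forall>X\<in>vector_fields A. T (f \<odot> X) = f \<odot> T X)"

definition tensor_02 ::
  "('a, 'e::euclidean_space) chart set \<Rightarrow> ('a vfield \<Rightarrow> 'a vfield \<Rightarrow> 'a \<Rightarrow> real) \<Rightarrow> bool" where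
  "tensor_02 A B \<longleftrightarrow>
     (\<forall>X\<in>vector_fields A. one_form A (B X)) \<and>
     (\<forall>Y\<in>vector_fields A. one_form A (\<lambda>X. B X Y))"

section \<open>Riemannian geometry\<close>

definition riemannian_metric ::
  "('a, 'e::euclidean_space) chart set \<Rightarrow> ('a vfield \<Rightarrow> 'a vfield \<Rightarrow> 'a \<Rightarrow> real) \<Rightarrow> bool" where
  "riemannian_metric A g \<longleftrightarrow>
     tensor_02 A g \<and>
     (\<forall>X\<in>vector_fields A. \<forall>Y\<in>vector_fields A. g X Y = g Y X) \<and>
     (\<forall>X\<in>vector_fields A. \<forall>p. \<not> vanishes_at X p \<longrightarrow> g X X p > 0)"

definition affine_connection ::
  "('a, 'e::euclidean_space) chart set \<Rightarrow> ('a vfield \<Rightarrow> 'a vfield \<Rightarrow> 'a vfield) \<Rightarrow> bool" where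
  "affine_connection A D \<longleftrightarrow>
     (\<forall>Y\<in>vector_fields A. tensor_11 A (\<lambda>X. D X Y)) \<and>
     (\<forall>X\<in>vector_fields A. \<forall>Y\<in>vector_fields A. \<forall>Z\<in>vector_fields A.
        D X (Y + Z) = D X Y + D X Z) \<and>
     (\<forall>f\<in>smooth_funs A. \<forall>X\<in>vector_fields A. \<forall>Y\<in>vector_fields A.
        D X (f \<odot> Y) = X f \<odot> Y + f \<odot> D X Y)"

definition levi_civita ::
  "('a, 'e::euclidean_space) chart set \<Rightarrow> ('a vfield \<Rightarrow> 'a vfield \<Rightarrow> 'a \<Rightarrow> real) \<Rightarrow>
   ('a vfield \<Rightarrow> 'a vfield \<Rightarrow> 'a vfield) \<Rightarrow> bool" where
  "levi_civita A g D \<longleftrightarrow>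
     affine_connection A D \<and>
     (\<forall>X\<in>vector_fields A. \<forall>Y\<in>vector_fields A. D X Y - D Y X = lie_bracket X Y) \<and>
     (\<forall>X\<in>vector_fields A. \<forall>Y\<in>vector_fields A. \<forall>Z\<in>vector_fields A.
        X (g Y Z) = g (D X Y) Z + g Y (D X Z))"

definition curvature ::
  "('a vfield \<Rightarrow> 'a vfield \<Rightarrow> 'a vfield) \<Rightarrow> 'a vfield \<Rightarrow> 'a vfield \<Rightarrow> 'a vfield \<Rightarrow> 'a vfield" where
  "curvature D X Y Z = D X (D Y Z) - D Y (D X Z) - D (lie_bracket X Y) Z"

text \<open>
  Global vector fields \<open>E 0, \<dots>, E (m - 1)\<close>, where \<open>m\<close> is the dimension, whose values at the single
  point \<open>p\<close> form an orthonormal basis of the tangent space.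
\<close>

definition orthonormal_at ::
  "('a, 'e::euclidean_space) chart set \<Rightarrow> ('a vfield \<Rightarrow> 'a vfield \<Rightarrow> 'a \<Rightarrow> real) \<Rightarrow> 'a \<Rightarrow>
   (nat \<Rightarrow> 'a vfield) \<Rightarrow> bool" where
  "orthonormal_at (A :: ('a, 'e) chart set) g p E \<longleftrightarrow>
     (\<forall>i<DIM('e). E i \<in> vector_fields A) \<and>
     (\<forall>i<DIM('e). \<forall>j<DIM('e). g (E i) (E j) p = (if i = j then 1 else 0))"

text \<open>
  The \<open>g\<close>-trace at \<open>p\<close> of a \<open>(0,2)\<close>-tensor field \<open>B\<close>; it does not depend on the frame chosen.
  The trace of a \<open>(1,1)\<close>-tensor field \<open>T\<close> is the \<open>g\<close>-trace of \<open>g (T Z) W\<close>.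
\<close>

definition metric_trace ::
  "('a, 'e::euclidean_space) chart set \<Rightarrow> ('a vfield \<Rightarrow> 'a vfield \<Rightarrow> 'a \<Rightarrow> real) \<Rightarrow>
   ('a vfield \<Rightarrow> 'a vfield \<Rightarrow> 'a \<Rightarrow> real) \<Rightarrow> 'a \<Rightarrow> real" where
  "metric_trace (A :: ('a, 'e) chart set) g B p =
     (let E = (SOME E. orthonormal_at A g p E) in \<Sum>i<DIM('e). B (E i) (E i) p)"

definition Ric ::
  "('a, 'e::euclidean_space) chart set \<Rightarrow> ('a vfield \<Rightarrow> 'a vfield \<Rightarrow> 'a \<Rightarrow> real) \<Rightarrow>
   ('a vfield \<Rightarrow> 'a vfield \<Rightarrow> 'a vfield) \<Rightarrow> 'a vfield \<Rightarrow> 'a vfield \<Rightarrow> 'a \<Rightarrow> real" where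
  "Ric A g D X Y = metric_trace A g (\<lambda>Z W. g (curvature D Z X Y) W)"

definition scal ::
  "('a, 'e::euclidean_space) chart set \<Rightarrow> ('a vfield \<Rightarrow> 'a vfield \<Rightarrow> 'a \<Rightarrow> real) \<Rightarrow>
   ('a vfield \<Rightarrow> 'a vfield \<Rightarrow> 'a vfield) \<Rightarrow> 'a \<Rightarrow> real" where
  "scal A g D = metric_trace A g (Ric A g D)"

definition divergence ::
  "('a, 'e::euclidean_space) chart set \<Rightarrow> ('a vfield \<Rightarrow> 'a vfield \<Rightarrow> 'a \<Rightarrow> real) \<Rightarrow>
   ('a vfield \<Rightarrow> 'a vfield \<Rightarrow> 'a vfield) \<Rightarrow> 'a vfield \<Rightarrow> 'a \<Rightarrow> real" where
  "divergence A g D V = metric_trace A g (\<lambda>Z W. g (D Z V) W)"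

definition solenoidal ::
  "('a, 'e::euclidean_space) chart set \<Rightarrow> ('a vfield \<Rightarrow> 'a vfield \<Rightarrow> 'a \<Rightarrow> real) \<Rightarrow>
   ('a vfield \<Rightarrow> 'a vfield \<Rightarrow> 'a vfield) \<Rightarrow> 'a vfield \<Rightarrow> bool" where
  "solenoidal A g D V \<longleftrightarrow> (\<forall>p. divergence A g D V p = 0)"

definition lie_derivative_02 ::
  "'a vfield \<Rightarrow> ('a vfield \<Rightarrow> 'a vfield \<Rightarrow> 'a \<Rightarrow> real) \<Rightarrow> 'a vfield \<Rightarrow> 'a vfield \<Rightarrow> 'a \<Rightarrow> real" where
  "lie_derivative_02 V h X Y = V (h X Y) - h (lie_bracket V X) Y - h X (lie_bracket V Y)"

text \<open>In the following definition, \<open>D\<close> is the Levi-Civita connection of \<open>h\<close>.\<close>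

definition almost_ricci_soliton ::
  "('a, 'e::euclidean_space) chart set \<Rightarrow> ('a vfield \<Rightarrow> 'a vfield \<Rightarrow> 'a \<Rightarrow> real) \<Rightarrow>
   ('a vfield \<Rightarrow> 'a vfield \<Rightarrow> 'a vfield) \<Rightarrow> 'a vfield \<Rightarrow> ('a \<Rightarrow> real) \<Rightarrow> bool" where
  "almost_ricci_soliton A h D V lam \<longleftrightarrow>
     riemannian_metric A h \<and> levi_civita A h D \<and>
     V \<in> vector_fields A \<and> (\<forall>p. \<not> vanishes_at V p) \<and> lam \<in> smooth_funs A \<and>
     (\<forall>X\<in>vector_fields A. \<forall>Y\<in>vector_fields A. \<forall>p.
        1/2 * lie_derivative_02 V h X Y p + Ric A h D X Y p = lam p * h X Y p)"

section \<open>Almost contact metric and Kenmotsu structures\<close>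

definition almost_contact_metric ::
  "('a, 'e::euclidean_space) chart set \<Rightarrow> ('a vfield \<Rightarrow> 'a vfield) \<Rightarrow> 'a vfield \<Rightarrow>
   ('a vfield \<Rightarrow> 'a \<Rightarrow> real) \<Rightarrow> ('a vfield \<Rightarrow> 'a vfield \<Rightarrow> 'a \<Rightarrow> real) \<Rightarrow> bool" where
  "almost_contact_metric A \<phi> \<xi> \<eta> g \<longleftrightarrow>
     riemannian_metric A g \<and> tensor_11 A \<phi> \<and> \<xi> \<in> vector_fields A \<and> one_form A \<eta> \<and>
     (\<forall>X\<in>vector_fields A. \<phi> (\<phi> X) = - X + \<eta> X \<odot> \<xi>) \<and>
     \<eta> \<xi> = 1 \<and>
     (\<forall>X\<in>vector_fields A. \<eta> X = g \<xi> X) \<and>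
     (\<forall>X\<in>vector_fields A. \<forall>Y\<in>vector_fields A. g (\<phi> X) (\<phi> Y) = g X Y - \<eta> X * \<eta> Y)"

text \<open>In the following definition, \<open>D\<close> is the Levi-Civita connection of \<open>g\<close>.\<close>

definition kenmotsu ::
  "('a, 'e::euclidean_space) chart set \<Rightarrow> ('a vfield \<Rightarrow> 'a vfield) \<Rightarrow> 'a vfield \<Rightarrow>
   ('a vfield \<Rightarrow> 'a \<Rightarrow> real) \<Rightarrow> ('a vfield \<Rightarrow> 'a vfield \<Rightarrow> 'a \<Rightarrow> real) \<Rightarrow>
   ('a vfield \<Rightarrow> 'a vfield \<Rightarrow> 'a vfield) \<Rightarrow> bool" where
  "kenmotsu A \<phi> \<xi> \<eta> g D \<longleftrightarrow>
     almost_contact_metric A \<phi> \<xi> \<eta> g \<and> levi_civita A g D \<and>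
     (\<forall>X\<in>vector_fields A. \<forall>Y\<in>vector_fields A.
        D X (\<phi> Y) - \<phi> (D X Y) = g (\<phi> X) Y \<odot> \<xi> - \<eta> Y \<odot> \<phi> X)"

definition D_homothetic ::
  "real \<Rightarrow>
   ('a vfield \<Rightarrow> 'a vfield) \<times> 'a vfield \<times> ('a vfield \<Rightarrow> 'a \<Rightarrow> real) \<times>
     ('a vfield \<Rightarrow> 'a vfield \<Rightarrow> 'a \<Rightarrow> real) \<Rightarrow>
   ('a vfield \<Rightarrow> 'a vfield) \<times> 'a vfield \<times> ('a vfield \<Rightarrow> 'a \<Rightarrow> real) \<times>
     ('a vfield \<Rightarrow> 'a vfield \<Rightarrow> 'a \<Rightarrow> real)" where
  "D_homothetic a = (\<lambda>(\<phi>, \<xi>, \<eta>, g).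
     (\<phi>, (\<lambda>_. 1 / a) \<odot> \<xi>, \<lambda>X p. a * \<eta> X p,
      \<lambda>X Y p. a * g X Y p + a * (a - 1) * \<eta> X p * \<eta> Y p))"

end

theory Submission
  imports Defs
begin

text \<open>
  The argument is a computation with tensors, but traces are taken over global vector fields that
  are orthonormal at one point only, and vector fields are derivations; so the tangent spaces have
  to be recovered from derivations first.

  Bump functions and Hadamard's lemma do this.  If \<open>\<kappa>\<close> is a bump function at \<open>p\<close>,
  \<open>x b\<close> are the cut-off coordinates and \<open>E b\<close> the cut-off coordinate fields, every vector field
  satisfies \<open>\<kappa>\<^sup>3 X = \<Sum>\<^sub>b (\<kappa> X(x b) - x b X(\<kappa>)) E b\<close> (\<open>coordinate_frame\<close>).
  Hence the value of a one-form on \<open>X\<close> at \<open>p\<close> depends linearly on the coordinates of \<open>X\<close> at \<open>p\<close>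
  (\<open>tangent_coordinates\<close>).  Linear algebra then gives orthonormal frames at \<open>p\<close>, the expansion
  of a one-form in such a frame (\<open>orthonormal_expansion\<close>), and a trace of \<open>(1,1)\<close>-tensors that is
  the same for all metrics (\<open>trace_metric_independent\<close>).

  On a Kenmotsu manifold \<open>\<nabla>\<^sub>X \<xi> = X - \<eta>(X) \<xi>\<close>, so \<open>\<nabla>\<eta>\<close> is the transverse metric
  \<open>gT = g - \<eta> \<otimes> \<eta>\<close> and \<open>Ric(\<xi>, \<xi>) = -2n\<close>.  With \<open>c = (a - 1)/a\<close>, the deformed metric has the
  connection \<open>\<nabla>'\<^sub>X Y = \<nabla>\<^sub>X Y + c gT(X, Y) \<xi>\<close> (\<open>D'_eq\<close>).  The curvature changes by
  \<open>c (gT(X, Y) Z - gT(Z, Y) X)\<close>, and taking the trace gives \<open>Ric' = Ric + 2n c gT\<close> (\<open>Ric'_eq\<close>).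

  The soliton equation at \<open>(\<xi>, \<xi>)\<close> reads \<open>a\<^sup>2 \<xi>(\<eta> V) - 2n = a\<^sup>2 lam\<close>, which is the formula for the
  soliton function.  Solving the soliton equation for \<open>Ric\<close> gives the second formula, and the
  \<open>g\<close>-trace of that formula gives the third: the divergence of \<open>V\<close> vanishes, and the terms that
  contain \<open>\<eta>\<close> cancel because the trace of \<open>\<eta> \<otimes> \<theta>\<close> is \<open>\<theta>(\<xi>)\<close>.
\<close>

section \<open>Smooth functions between Euclidean spaces\<close>

lemma Ck_on_Suc_deriv:
  assumes "Ck_on (Suc k) S f" "open S" "x \<in> S"
  shows "(f has_derivative frechet_derivative f (at x)) (at x)"
  using assms by (auto simp: differentiable_on_eq_differentiable_at frechet_derivative_works)

lemma Ck_on_cong: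
  fixes f g :: "'e::euclidean_space \<Rightarrow> 'f::real_normed_vector"
  assumes "open S" "\<And>x. x \<in> S \<Longrightarrow> f x = g x" "Ck_on k S f"
  shows "Ck_on k S g"
  using assms(2,3)
proof (induction k arbitrary: f g)
  case 0
  then show ?case by (auto cong: continuous_on_cong)
next
  case (Suc k)
  have der: "(g has_derivative frechet_derivative f (at x)) (at x)" if "x \<in> S" for x
    by (rule has_derivative_transform_within_open[OF Ck_on_Suc_deriv[OF Suc.prems(2) assms(1) that]
          assms(1) that Suc.prems(1)])
  then have "g differentiable_on S"
    unfolding differentiable_on_eq_differentiable_at[OF assms(1)] differentiable_def by blast
  moreover have "Ck_on k S (\<lambda>x. frechet_derivative g (at x) v)" for v
  proof (rule Suc.IH)
    show "Ck_on k S (\<lambda>x. frechet_derivative f (at x) v)" using Suc.prems(2) by simp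
  qed (simp add: frechet_derivative_at[OF der])
  ultimately show ?case by simp
qed

text \<open>
  The derivative may be given by any formula that is valid on the open set \<open>S\<close>.  The closure
  properties of \<open>Ck_on\<close> are inductions on the order that use this rule in the step.
\<close>

lemma Ck_on_SucI:
  fixes f :: "'e::euclidean_space \<Rightarrow> 'f::real_normed_vector"
  assumes S: "open S" and f: "\<And>x. x \<in> S \<Longrightarrow> (f has_derivative f' x) (at x)"
    and f': "\<And>v. Ck_on k S (\<lambda>x. f' x v)"
  shows "Ck_on (Suc k) S f"
proof -
  have "f differentiable_on S"
    unfolding differentiable_on_eq_differentiable_at[OF S] differentiable_def using f by blast
  moreover have "Ck_on k S (\<lambda>x. frechet_derivative f (at x) v)" for v
    by (rule Ck_on_cong[OF S _ f'[of v]]) (simp add: frechet_derivative_at[OF f])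
  ultimately show ?thesis by simp
qed

lemma Ck_on_subset: "Ck_on k S f \<Longrightarrow> T \<subseteq> S \<Longrightarrow> Ck_on k T f"
  by (induction k arbitrary: f) (auto intro: continuous_on_subset differentiable_on_subset)

lemma Ck_on_locally:
  assumes "open S" "\<And>x. x \<in> S \<Longrightarrow> \<exists>T. open T \<and> x \<in> T \<and> Ck_on k T f"
  shows "Ck_on k S f"
  using assms(2)
proof (induction k arbitrary: f)
  case 0
  then show ?case using assms(1)
    by (metis Ck_on.simps(1) continuous_at_imp_continuous_on continuous_on_eq_continuous_at)
next
  case (Suc k)
  have "f differentiable_on S"
    unfolding differentiable_on_eq_differentiable_at[OF assms(1)]
    using Suc.prems by (metis Ck_on.simps(2) differentiable_on_eq_differentiable_at)
  then show ?case using Suc.prems by (fastforce intro!: Suc.IH)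
qed

lemma Ck_on_SucD: "Ck_on (Suc k) S f \<Longrightarrow> Ck_on k S f"
proof (induction k arbitrary: f)
  case 0
  then show ?case by (auto intro: differentiable_imp_continuous_on)
next
  case (Suc k)
  then show ?case by (metis Ck_on.simps(2))
qed

lemma Ck_on_const: "open S \<Longrightarrow> Ck_on k S (\<lambda>x. c)"
proof (induction k arbitrary: c)
  case (Suc k)
  then show ?case by (intro Ck_on_SucI[where f'="\<lambda>_ _. 0"]) auto
qed simp

lemma Ck_on_linear:
  assumes "open S" "bounded_linear l"
  shows "Ck_on k S (\<lambda>x. l x)"
proof (cases k)
  case 0
  then show ?thesis using assms(2) by (simp add: linear_continuous_on)
next
  case (Suc m)
  show ?thesis unfolding Suc
    by (rule Ck_on_SucI[OF assms(1), where f'="\<lambda>_. l"])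
      (use assms bounded_linear_imp_has_derivative Ck_on_const in blast)+
qed

lemma Ck_on_add:
  assumes "open S" "Ck_on k S f" "Ck_on k S g"
  shows "Ck_on k S (\<lambda>x. f x + g x)"
  using assms(2,3)
proof (induction k arbitrary: f g)
  case (Suc k)
  then show ?case
    by (intro Ck_on_SucI[OF assms(1),
          where f'="\<lambda>x v. frechet_derivative f (at x) v + frechet_derivative g (at x) v"])
      (auto intro!: has_derivative_add Ck_on_Suc_deriv[OF _ assms(1)])
qed (auto intro: continuous_on_add)

lemma Ck_on_mult:
  fixes f g :: "'e::euclidean_space \<Rightarrow> real"
  assumes "open S" "Ck_on k S f" "Ck_on k S g"
  shows "Ck_on k S (\<lambda>x. f x * g x)"
  using assms(2,3)
proof (induction k arbitrary: f g)
  case (Suc k)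
  show ?case
  proof (rule Ck_on_SucI[OF assms(1),
          where f'="\<lambda>x v. f x * frechet_derivative g (at x) v + frechet_derivative f (at x) v * g x"])
    show "Ck_on k S (\<lambda>x. f x * frechet_derivative g (at x) v + frechet_derivative f (at x) v * g x)" for v
      using Suc.prems Ck_on_SucD[OF Suc.prems(1)] Ck_on_SucD[OF Suc.prems(2)]
      by (intro Ck_on_add assms(1) Suc.IH) auto
  qed (rule has_derivative_mult; rule Ck_on_Suc_deriv[OF _ assms(1)]; use Suc.prems in blast)
qed (auto intro: continuous_on_mult)

lemma Ck_on_sum:
  assumes "open S" "\<And>i. i \<in> I \<Longrightarrow> Ck_on k S (f i)"
  shows "Ck_on k S (\<lambda>x. \<Sum>i\<in>I. f i x)"
proof (cases "finite I")
  case True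
  then show ?thesis using assms(2)
    by (induction I) (auto intro: Ck_on_const Ck_on_add assms(1))
qed (auto intro: Ck_on_const assms(1))

lemma Ck_on_inner_right:
  assumes "open S" "Ck_on k S f"
  shows "Ck_on k S (\<lambda>x. f x \<bullet> b)"
  using assms(2)
proof (induction k arbitrary: f)
  case (Suc k)
  then show ?case
    by (intro Ck_on_SucI[OF assms(1),
          where f'="\<lambda>x v. frechet_derivative f (at x) v \<bullet> b"])
      (auto intro!: has_derivative_inner_left Ck_on_Suc_deriv[OF _ assms(1)])
qed (auto intro: continuous_intros)

text \<open>
  The chain rule is expanded over the basis, so that the derivative of the composition is a sum of
  products to which the induction hypothesis and \<open>Ck_on_mult\<close> apply.
\<close>

lemma Ck_on_compose:
  fixes f :: "'e::euclidean_space \<Rightarrow> 'd::euclidean_space" and h :: "'d \<Rightarrow> real"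
  assumes "open S" "open T" "f ` S \<subseteq> T" "Ck_on k S f" "Ck_on k T h"
  shows "Ck_on k S (\<lambda>x. h (f x))"
  using assms(4,5)
proof (induction k arbitrary: h)
  case 0
  then show ?case using assms(3) by (auto intro: continuous_on_compose2)
next
  case (Suc k)
  let ?f' = "\<lambda>x. frechet_derivative f (at x)" and ?h' = "\<lambda>y. frechet_derivative h (at y)"
  have fd: "(f has_derivative ?f' x) (at x)" if "x \<in> S" for x
    using Suc.prems(1) assms(1) that by (rule Ck_on_Suc_deriv)
  have hd: "(h has_derivative ?h' y) (at y)" if "y \<in> T" for y
    using Suc.prems(2) assms(2) that by (rule Ck_on_Suc_deriv)
  show ?case
  proof (rule Ck_on_SucI[OF assms(1), where f'="\<lambda>x v. \<Sum>b\<in>Basis. (?f' x v \<bullet> b) * ?h' (f x) b"])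
    fix x assume x: "x \<in> S"
    then have "f x \<in> T" using assms(3) by auto
    from hd[OF this] have h: "(h has_derivative ?h' (f x)) (at (f x))" .
    have "?h' (f x) v = (\<Sum>b\<in>Basis. (v \<bullet> b) * ?h' (f x) b)" for v
    proof -
      interpret linear "?h' (f x)" using h has_derivative_linear by blast
      have "?h' (f x) v = ?h' (f x) (\<Sum>b\<in>Basis. (v \<bullet> b) *\<^sub>R b)"
        by (simp add: euclidean_representation)
      then show ?thesis by (simp add: sum scale)
    qed
    then have "(\<lambda>v. \<Sum>b\<in>Basis. (?f' x v \<bullet> b) * ?h' (f x) b) = (\<lambda>v. ?h' (f x) (?f' x v))"
      by metis
    then show "((\<lambda>x. h (f x)) has_derivative (\<lambda>v. \<Sum>b\<in>Basis. (?f' x v \<bullet> b) * ?h' (f x) b)) (at x)"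
      using has_derivative_compose[OF fd[OF x] h] by simp
  next
    fix v
    show "Ck_on k S (\<lambda>x. \<Sum>b\<in>Basis. (?f' x v \<bullet> b) * ?h' (f x) b)"
      using Suc.prems Ck_on_SucD[OF Suc.prems(1)]
      by (intro Ck_on_sum Ck_on_mult Ck_on_inner_right assms(1) Suc.IH) auto
  qed
qed

text \<open>
  The derivatives of \<open>exp (- 1 / t)\<close> are combinations of the functions \<open>exp (- 1 / t) / t ^ m\<close>;
  treating all \<open>m\<close> together makes smoothness a single induction.
\<close>

definition flat_exp :: "nat \<Rightarrow> real \<Rightarrow> real" where
  "flat_exp m t = (if t > 0 then exp (- (1 / t)) / t ^ m else 0)"

lemma flat_exp_tendsto_0: "(flat_exp m \<longlongrightarrow> 0) (at 0)"
proof -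
  have "((\<lambda>x::real. x ^ m / exp x) \<longlongrightarrow> 0) at_top" by (rule tendsto_power_div_exp_0)
  then have "((\<lambda>t::real. inverse t ^ m / exp (inverse t)) \<longlongrightarrow> 0) (at_right 0)"
    by (rule filterlim_compose[OF _ filterlim_inverse_at_top_right])
  then have "(flat_exp m \<longlongrightarrow> 0) (at_right 0)"
    by (rule Lim_transform_eventually)
      (auto simp: flat_exp_def eventually_at_right_less field_simps exp_minus
        intro!: eventually_mono[OF eventually_at_right_less[of 0]])
  moreover have "(flat_exp m \<longlongrightarrow> 0) (at_left 0)"
    by (rule Lim_transform_eventually[OF tendsto_const])
      (auto simp: flat_exp_def eventually_at_left_field intro!: exI[of _ "-1"])
  ultimately show ?thesis by (simp add: filterlim_split_at)
qed

text \<open>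
  At \<open>0\<close> the difference quotient of \<open>flat_exp m\<close> is \<open>flat_exp (Suc m)\<close>, which tends to \<open>0\<close>.
\<close>

lemma flat_exp_deriv:
  "(flat_exp m has_real_derivative flat_exp (m + 2) t - real m * flat_exp (m + 1) t) (at t)"
proof -
  consider "t > 0" | "t < 0" | "t = 0" by linarith
  then show ?thesis
  proof cases
    case 1
    have "((\<lambda>t. exp (- (1 / t)) / t ^ m) has_real_derivative
        flat_exp (m + 2) t - real m * flat_exp (m + 1) t) (at t)"
    proof (cases m)
      case (Suc j)
      have "((\<lambda>t. t ^ m) has_real_derivative real m * t ^ j) (at t)"
        using DERIV_pow[of m t UNIV] Suc by simp
      moreover have "((\<lambda>t. exp (- (1 / t))) has_real_derivative exp (- (1 / t)) * (1 / t\<^sup>2)) (at t)"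
        using 1 by (auto intro!: derivative_eq_intros simp: power2_eq_square)
      ultimately have "((\<lambda>t. exp (- (1 / t)) / t ^ m) has_real_derivative
          (exp (- (1 / t)) * (1 / t\<^sup>2) * t ^ m - exp (- (1 / t)) * (real m * t ^ j)) / (t ^ m * t ^ m)) (at t)"
        using 1 by (intro DERIV_divide) auto
      moreover have "(exp (- (1 / t)) * (1 / t\<^sup>2) * t ^ m - exp (- (1 / t)) * (real m * t ^ j)) / (t ^ m * t ^ m)
          = flat_exp (m + 2) t - real m * flat_exp (m + 1) t"
        using 1 Suc by (simp add: flat_exp_def field_simps power2_eq_square)
      ultimately show ?thesis by simp
    qed (use 1 in \<open>auto intro!: derivative_eq_intros simp: flat_exp_def field_simps power2_eq_square\<close>)
    then show ?thesis
      by (rule has_field_derivative_transform_within_open[where S="{0<..}"]) (use 1 in \<open>auto simp: flat_exp_def\<close>)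
  next
    case 2
    have "((\<lambda>t. 0) has_real_derivative flat_exp (m + 2) t - real m * flat_exp (m + 1) t) (at t)"
      using 2 by (auto simp: flat_exp_def)
    then show ?thesis
      by (rule has_field_derivative_transform_within_open[where S="{..<0}"]) (use 2 in \<open>auto simp: flat_exp_def\<close>)
  next
    case 3
    have "((\<lambda>h. (flat_exp m (0 + h) - flat_exp m 0) / h) \<longlongrightarrow> 0) (at 0)"
      by (rule Lim_transform_eventually[OF flat_exp_tendsto_0[of "Suc m"]])
        (auto simp: flat_exp_def eventually_at_filter)
    then show ?thesis unfolding 3 DERIV_def by (simp add: flat_exp_def)
  qed
qed

lemma Ck_on_flat_exp: "Ck_on k UNIV (flat_exp m)"
proof (induction k arbitrary: m)
  case 0
  have "isCont (flat_exp m) t" for t using flat_exp_deriv DERIV_isCont by blast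
  then show ?case by (simp add: continuous_at_imp_continuous_on)
next
  case (Suc k)
  show ?case
  proof (rule Ck_on_SucI)
    show "(flat_exp m has_derivative (\<lambda>v. (flat_exp (m + 2) t + (- real m) * flat_exp (m + 1) t) * v)) (at t)" for t
      using flat_exp_deriv[of m t] by (simp add: has_field_derivative_def)
    show "Ck_on k UNIV (\<lambda>t. (flat_exp (m + 2) t + (- real m) * flat_exp (m + 1) t) * v)" for v
      by (intro Ck_on_mult Ck_on_add Ck_on_const Suc.IH open_UNIV)
  qed auto
qed

text \<open>
  The bump is \<open>flat_exp 0\<close> of the polynomial \<open>r\<^sup>2 - dist c x\<^sup>2\<close>, normalised at the centre.
\<close>

lemma ball_bump_exists:
  fixes c :: "'e::euclidean_space"
  assumes "r > 0"
  obtains \<beta> :: "'e \<Rightarrow> real" where "smooth_on UNIV \<beta>" "\<And>x. dist c x \<ge> r \<Longrightarrow> \<beta> x = 0" "\<beta> c = 1"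
proof
  define s where "s x = r\<^sup>2 + (\<Sum>b\<in>Basis. - 1 * (((x - c) \<bullet> b) * ((x - c) \<bullet> b)))" for x
  have s: "s x = r\<^sup>2 - (dist c x)\<^sup>2" for x
  proof -
    have "(dist c x)\<^sup>2 = (x - c) \<bullet> (x - c)"
      by (metis dist_commute dist_norm power2_norm_eq_inner)
    then show ?thesis by (simp add: s_def sum_negf euclidean_inner[of "x - c" "x - c"])
  qed
  let ?\<beta> = "\<lambda>x. inverse (flat_exp 0 (r\<^sup>2)) * flat_exp 0 (s x)"
  have lin: "Ck_on k UNIV (\<lambda>x. (x - c) \<bullet> b)" for k and b :: 'e
    using Ck_on_add[OF open_UNIV Ck_on_linear[OF open_UNIV bounded_linear_inner_left[of b]]
        Ck_on_const[OF open_UNIV], of k "- c \<bullet> b"] by (simp add: inner_diff_left)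
  have "Ck_on k UNIV s" for k
    unfolding s_def by (intro Ck_on_add Ck_on_sum Ck_on_mult Ck_on_const lin open_UNIV)
  then have "Ck_on k UNIV (\<lambda>x. flat_exp 0 (s x))" for k
    using Ck_on_compose[OF open_UNIV open_UNIV _ _ Ck_on_flat_exp] by blast
  then have "Ck_on k UNIV ?\<beta>" for k
    by (rule Ck_on_mult[OF open_UNIV Ck_on_const[OF open_UNIV]])
  then show "smooth_on UNIV ?\<beta>" by (simp add: smooth_on_def)
  show "?\<beta> x = 0" if "dist c x \<ge> r" for x
  proof -
    have "r\<^sup>2 \<le> (dist c x)\<^sup>2" using that assms by (intro power_mono) auto
    then show ?thesis by (simp add: s flat_exp_def)
  qed
  show "?\<beta> c = 1" using assms by (simp add: s flat_exp_def)
qed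

text \<open>
  Differentiating under the integral sign produces a factor \<open>t\<close>.  The weight \<open>t ^ m\<close> absorbs it,
  so that the derivative is again an average of the same kind.
\<close>

lemma Ck_on_ray_average:
  fixes f :: "'e::euclidean_space \<Rightarrow> real"
  assumes S: "open S" "convex S" "q \<in> S" and "Ck_on k S f"
  shows "Ck_on k S (\<lambda>x. integral {0..1} (\<lambda>t. t ^ m * f (q + t *\<^sub>R (x - q))))"
  using assms(4)
proof (induction k arbitrary: f m)
  case 0
  have seg: "q + t *\<^sub>R (x - q) \<in> S" if "x \<in> S" "t \<in> {0..1}" for x t
    using that S convexD_alt[OF S(2,3), of x t] by (simp add: algebra_simps)
  have "continuous_on (S \<times> cbox 0 1) (\<lambda>(x, t). t ^ m * f (q + t *\<^sub>R (x - q)))"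
    unfolding split_beta
    by (intro continuous_intros continuous_on_compose2[OF 0[simplified]]) (use seg in auto)
  from integral_continuous_on_param[OF this] show ?case by simp
next
  case (Suc k)
  have seg: "q + t *\<^sub>R (x - q) \<in> S" if "x \<in> S" "t \<in> {0..1}" for x t
    using that S convexD_alt[OF S(2,3), of x t] by (simp add: algebra_simps)
  let ?f' = "\<lambda>x. frechet_derivative f (at x)"
  have fd: "(f has_derivative ?f' x) (at x)" if "x \<in> S" for x
    using Suc.prems(1) S(1) that by (rule Ck_on_Suc_deriv)
  have cf: "continuous_on S f"
    using Suc.prems by (simp add: differentiable_imp_continuous_on)
  have cf': "continuous_on S (\<lambda>x. ?f' x b)" for b
  proof -
    have "Ck_on j S f \<Longrightarrow> Ck_on 0 S f" for j and f :: "'e \<Rightarrow> real"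
      by (induction j) (use Ck_on_SucD in auto)
    then show ?thesis using Suc.prems by (metis Ck_on.simps)
  qed
  have f'_sum: "?f' x v = (\<Sum>b\<in>Basis. ?f' x b * (v \<bullet> b))" if "x \<in> S" for x v
  proof -
    interpret linear "?f' x" using fd[OF that] has_derivative_linear by blast
    have "?f' x v = ?f' x (\<Sum>b\<in>Basis. (v \<bullet> b) *\<^sub>R b)" by (simp add: euclidean_representation)
    then show ?thesis by (simp add: sum scale mult.commute)
  qed
  \<comment> \<open>the derivative of the integrand in \<open>x\<close>, as a bounded linear map\<close>
  define L where "L x t = (\<Sum>b\<in>Basis. (t ^ Suc m * ?f' (q + t *\<^sub>R (x - q)) b) *\<^sub>R blinfun_inner_left b)"
    for x t
  have L: "blinfun_apply (L x t) v = t ^ Suc m * ?f' (q + t *\<^sub>R (x - q)) v"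
    if "x \<in> S" "t \<in> {0..1}" for x t v
    unfolding L_def blinfun.sum_left blinfun.scaleR_left blinfun_inner_left.rep_eq
      f'_sum[OF seg[OF that], of v] sum_distrib_left
    by (rule sum.cong) (simp_all add: inner_commute)
  have contL: "continuous_on (S \<times> cbox 0 1) (\<lambda>(x, t). L x t)"
    unfolding L_def split_beta
    by (intro continuous_intros continuous_on_compose2[OF cf']) (use seg in auto)
  have leibniz: "((\<lambda>x. integral (cbox 0 1) (\<lambda>t. t ^ m * f (q + t *\<^sub>R (x - q)))) has_derivative
      blinfun_apply (integral (cbox 0 1) (L x))) (at x within S)" if x: "x \<in> S" for x
  proof (rule leibniz_rule[OF _ _ contL x S(2)])
    fix x t assume x: "x \<in> S" and t: "t \<in> cbox 0 (1::real)"
    have "((\<lambda>x. q + t *\<^sub>R (x - q)) has_derivative (\<lambda>v. t *\<^sub>R v)) (at x)"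
      by (auto intro!: derivative_eq_intros simp: algebra_simps)
    from has_derivative_compose[OF this fd[OF seg]] x t
    have "((\<lambda>x. f (q + t *\<^sub>R (x - q))) has_derivative (\<lambda>v. ?f' (q + t *\<^sub>R (x - q)) (t *\<^sub>R v))) (at x)"
      by auto
    from has_derivative_mult_right[OF this, of "t ^ m"]
    have "((\<lambda>x. t ^ m * f (q + t *\<^sub>R (x - q))) has_derivative
        (\<lambda>v. t ^ m * ?f' (q + t *\<^sub>R (x - q)) (t *\<^sub>R v))) (at x)" .
    moreover have "(\<lambda>v. t ^ m * ?f' (q + t *\<^sub>R (x - q)) (t *\<^sub>R v)) = blinfun_apply (L x t)"
      using t by (simp add: fun_eq_iff L[OF x] linear_scale[OF has_derivative_linear[OF fd[OF seg[OF x]]]])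
    ultimately show "((\<lambda>x. t ^ m * f (q + t *\<^sub>R (x - q))) has_derivative blinfun_apply (L x t))
        (at x within S)"
      by (simp add: has_derivative_at_withinI)
  next
    fix x assume "x \<in> S"
    then show "(\<lambda>t. t ^ m * f (q + t *\<^sub>R (x - q))) integrable_on cbox 0 1"
      by (intro integrable_continuous continuous_intros continuous_on_compose2[OF cf]) (use seg in auto)
  qed
  have der: "((\<lambda>x. integral {0..1} (\<lambda>t. t ^ m * f (q + t *\<^sub>R (x - q)))) has_derivative
      blinfun_apply (integral {0..1} (L x))) (at x)" if "x \<in> S" for x
    using leibniz[OF that] at_within_open[OF that S(1)] by simp
  have val: "blinfun_apply (integral {0..1} (L x)) v
      = integral {0..1} (\<lambda>t. t ^ Suc m * ?f' (q + t *\<^sub>R (x - q)) v)" if x: "x \<in> S" for x v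
  proof -
    have "continuous_on {0..1} (L x)"
      using continuous_on_compose2[OF contL continuous_on_Pair[OF continuous_on_const continuous_on_id],
          of x "{0..1}"] x by (simp add: image_subset_iff)
    then have "L x integrable_on {0..1}" by (rule integrable_continuous_real)
    from blinfun_apply_integral[OF this, of v] show ?thesis
      using x L by (auto intro!: integral_cong)
  qed
  show ?case
  proof (rule Ck_on_SucI[OF S(1) der])
    fix v
    have "Ck_on k S (\<lambda>x. integral {0..1} (\<lambda>t. t ^ Suc m * ?f' (q + t *\<^sub>R (x - q)) v))"
      using Suc.prems by (intro Suc.IH) simp
    then show "Ck_on k S (\<lambda>x. blinfun_apply (integral {0..1} (L x)) v)"
      by (rule Ck_on_cong[OF S(1), rotated]) (use val in auto)
  qed
qed

text \<open>
  The fundamental theorem of calculus along the segment from \<open>q\<close> to \<open>x\<close> yields \<open>h b\<close> as the average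
  of the partial derivative in direction \<open>b\<close>.
\<close>

lemma Hadamard_lemma:
  fixes f :: "'e::euclidean_space \<Rightarrow> real"
  assumes S: "open S" "convex S" "q \<in> S" and f: "smooth_on S f"
  obtains h where "\<And>b. smooth_on S (h b)"
    and "\<And>x. x \<in> S \<Longrightarrow> f x = f q + (\<Sum>b\<in>Basis. ((x - q) \<bullet> b) * h b x)"
    and "\<And>b. h b q = frechet_derivative f (at q) b"
proof
  let ?f' = "\<lambda>x. frechet_derivative f (at x)"
  let ?h = "\<lambda>b x. integral {0..1} (\<lambda>t. t ^ 0 * ?f' (q + t *\<^sub>R (x - q)) b)"
  have ck: "Ck_on k S (\<lambda>x. ?f' x b)" for k b
    using f unfolding smooth_on_def by (metis Ck_on.simps(2))
  show "smooth_on S (?h b)" for b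
    unfolding smooth_on_def using Ck_on_ray_average[OF S ck] by blast
  show "?h b q = ?f' q b" for b by simp
  fix x assume x: "x \<in> S"
  have seg: "q + t *\<^sub>R (x - q) \<in> S" if "t \<in> {0..1}" for t
    using that S x convexD_alt[OF S(2,3), of x t] by (simp add: algebra_simps)
  have fd: "(f has_derivative ?f' y) (at y)" if "y \<in> S" for y
    using f S(1) that unfolding smooth_on_def by (metis Ck_on_Suc_deriv)
  have "((\<lambda>t. ?f' (q + t *\<^sub>R (x - q)) (x - q)) has_integral
      f (q + 1 *\<^sub>R (x - q)) - f (q + 0 *\<^sub>R (x - q))) {0..1}"
  proof (rule fundamental_theorem_of_calculus)
    fix t :: real assume t: "t \<in> {0..1}"
    have "((\<lambda>t. q + t *\<^sub>R (x - q)) has_derivative (\<lambda>s. s *\<^sub>R (x - q))) (at t within {0..1})"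
      by (auto intro!: derivative_eq_intros)
    from has_derivative_compose[OF this fd[OF seg[OF t]]]
    show "((\<lambda>t. f (q + t *\<^sub>R (x - q))) has_vector_derivative ?f' (q + t *\<^sub>R (x - q)) (x - q))
        (at t within {0..1})"
      unfolding has_vector_derivative_def
      by (simp add: linear_scale[OF has_derivative_linear[OF fd[OF seg[OF t]]]])
  qed simp
  then have "f x - f q = integral {0..1} (\<lambda>t. ?f' (q + t *\<^sub>R (x - q)) (x - q))"
    by (simp add: integral_unique)
  also have "\<dots> = integral {0..1} (\<lambda>t. \<Sum>b\<in>Basis. ((x - q) \<bullet> b) * ?f' (q + t *\<^sub>R (x - q)) b)"
  proof (rule integral_cong)
    fix t :: real assume t: "t \<in> {0..1}"
    interpret linear "?f' (q + t *\<^sub>R (x - q))" using fd[OF seg[OF t]] has_derivative_linear by blast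
    show "?f' (q + t *\<^sub>R (x - q)) (x - q) = (\<Sum>b\<in>Basis. ((x - q) \<bullet> b) * ?f' (q + t *\<^sub>R (x - q)) b)"
      by (subst (3) euclidean_representation[symmetric], subst sum) (simp add: scale)
  qed
  also have "\<dots> = (\<Sum>b\<in>Basis. ((x - q) \<bullet> b) * ?h b x)"
  proof (subst integral_sum)
    fix b :: 'e
    have "continuous_on S (\<lambda>y. ?f' y b)" using ck[of 0] by simp
    then show "(\<lambda>t. (x - q) \<bullet> b * ?f' (q + t *\<^sub>R (x - q)) b) integrable_on {0..1}"
      by (intro integrable_continuous_real continuous_intros) 
        (auto intro!: continuous_on_compose2[of S] continuous_intros seg)
  qed auto
  finally show "f x = f q + (\<Sum>b\<in>Basis. ((x - q) \<bullet> b) * ?h b x)" by simp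
qed

section \<open>Vector fields and coordinate frames on a manifold\<close>

lemma sum_fun_apply: "(\<Sum>i\<in>I. f i) x = (\<Sum>i\<in>I. f i x)"
  by (induction I rule: infinite_finite_induct) auto

lemma vscale_0_right [simp]: "f \<odot> (0 :: 'b vfield) = 0"
  and vscale_0_left [simp]: "0 \<odot> X = (0 :: 'b vfield)"
  and vscale_1_left [simp]: "1 \<odot> X = (X :: 'b vfield)"
  by (simp_all add: vscale_def fun_eq_iff)

locale smooth_manifold =
  fixes A :: "('a::{t2_space, second_countable_topology}, 'e::euclidean_space) chart set"
  assumes atlas: "smooth_atlas A"
begin

abbreviation "SF \<equiv> smooth_funs A"
abbreviation "VF \<equiv> vector_fields A"

lemma open_chart_image: "(U, \<psi>) \<in> A \<Longrightarrow> open (\<psi> ` U)"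
  using atlas by (auto simp: smooth_atlas_def is_chart_def)

lemma chart:
  assumes "(U, \<psi>) \<in> A"
  shows "open U" "homeomorphism U (\<psi> ` U) \<psi> (inv_into U \<psi>)" "inj_on \<psi> U" "continuous_on U \<psi>"
    "continuous_on (\<psi> ` U) (inv_into U \<psi>)"
proof -
  show *: "open U" "homeomorphism U (\<psi> ` U) \<psi> (inv_into U \<psi>)"
    using assms atlas by (auto simp: smooth_atlas_def is_chart_def)
  from *(2) show "inj_on \<psi> U" by (metis homeomorphism_apply1 inj_on_inverseI)
  from *(2) show "continuous_on U \<psi>" "continuous_on (\<psi> ` U) (inv_into U \<psi>)"
    by (auto simp: homeomorphism_def)
qed

lemma open_chart_image_subset:
  assumes "(U, \<psi>) \<in> A" "open N" "N \<subseteq> U"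
  shows "open (\<psi> ` N)"
proof -
  have "openin (top_of_set U) N" using assms by (simp add: openin_open_eq chart(1))
  then have "openin (top_of_set (\<psi> ` U)) (\<psi> ` N)"
    using chart(2)[OF assms(1)] homeomorphism_imp_open_map by blast
  then show ?thesis using openin_open_trans open_chart_image[OF assms(1)] by blast
qed

lemma SF_Ck_on: "f \<in> SF \<Longrightarrow> (U, \<psi>) \<in> A \<Longrightarrow> Ck_on k (\<psi> ` U) (\<lambda>x. f (inv_into U \<psi> x))"
  by (auto simp: smooth_funs_def smooth_on_def comp_def)

lemma SF_I:
  assumes "\<And>U \<psi> k. (U, \<psi>) \<in> A \<Longrightarrow> Ck_on k (\<psi> ` U) (\<lambda>x. f (inv_into U \<psi> x))"
  shows "f \<in> SF"
  using assms by (auto simp: smooth_funs_def smooth_on_def comp_def)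

lemma SF_const [simp, intro]: "(\<lambda>_. c) \<in> SF"
  by (rule SF_I) (simp add: Ck_on_const open_chart_image)

lemma SF_add [simp, intro]: "f \<in> SF \<Longrightarrow> h \<in> SF \<Longrightarrow> f + h \<in> SF"
  by (rule SF_I) (simp add: Ck_on_add open_chart_image SF_Ck_on)

lemma SF_mult [simp, intro]: "f \<in> SF \<Longrightarrow> h \<in> SF \<Longrightarrow> f * h \<in> SF"
  by (rule SF_I) (simp add: Ck_on_mult open_chart_image SF_Ck_on)

lemma SF_0 [simp, intro]: "0 \<in> SF" and SF_1 [simp, intro]: "1 \<in> SF"
  by (simp_all add: zero_fun_def one_fun_def)

lemma SF_uminus [simp, intro]: "f \<in> SF \<Longrightarrow> - f \<in> SF"
proof -
  assume "f \<in> SF"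
  then have "(\<lambda>_. - 1) * f \<in> SF" by blast
  moreover have "(\<lambda>_. - 1) * f = - f" by (simp add: fun_eq_iff)
  ultimately show ?thesis by simp
qed

lemma SF_diff [simp, intro]: "f \<in> SF \<Longrightarrow> h \<in> SF \<Longrightarrow> f - h \<in> SF"
  using SF_add[of f "- h"] by simp

lemma SF_sum [intro]: "(\<And>i. i \<in> I \<Longrightarrow> f i \<in> SF) \<Longrightarrow> (\<Sum>i\<in>I. f i) \<in> SF"
  by (induction I rule: infinite_finite_induct) auto

lemma VF_SF: "X \<in> VF \<Longrightarrow> f \<in> SF \<Longrightarrow> X f \<in> SF"
  and VF_nonsmooth: "X \<in> VF \<Longrightarrow> f \<notin> SF \<Longrightarrow> X f = 0"
  and VF_add_fun: "X \<in> VF \<Longrightarrow> f \<in> SF \<Longrightarrow> h \<in> SF \<Longrightarrow> X (f + h) = X f + X h"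
  and VF_scale_fun: "X \<in> VF \<Longrightarrow> f \<in> SF \<Longrightarrow> X ((\<lambda>_. c) * f) = (\<lambda>_. c) * X f"
  and VF_mult_fun: "X \<in> VF \<Longrightarrow> f \<in> SF \<Longrightarrow> h \<in> SF \<Longrightarrow> X (f * h) = f * X h + h * X f"
  by (simp_all add: vector_fields_def)

lemma VF_0_fun: "X \<in> VF \<Longrightarrow> X 0 = 0"
  using VF_scale_fun[of X 0 0] by (simp add: fun_eq_iff)

lemma VF_uminus_fun: "X \<in> VF \<Longrightarrow> f \<in> SF \<Longrightarrow> X (- f) = - X f"
proof -
  assume "X \<in> VF" "f \<in> SF"
  moreover have "(\<lambda>_. - 1) * h = - h" for h :: "'a \<Rightarrow> real" by (simp add: fun_eq_iff)
  ultimately show ?thesis using VF_scale_fun[of X f "-1"] by simp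
qed

lemma VF_diff_fun: "X \<in> VF \<Longrightarrow> f \<in> SF \<Longrightarrow> h \<in> SF \<Longrightarrow> X (f - h) = X f - X h"
  using VF_add_fun[of X f "- h"] VF_uminus_fun[of X h] by simp

lemma VF_const_fun: "X \<in> VF \<Longrightarrow> X (\<lambda>_. c) = 0"
proof -
  assume X: "X \<in> VF"
  have "X 1 = 0" using VF_mult_fun[OF X SF_1 SF_1] by simp
  moreover have "(\<lambda>_. c) = (\<lambda>_. c) * 1" by (simp add: fun_eq_iff)
  ultimately show ?thesis using VF_scale_fun[OF X SF_1, of c] by (metis mult_zero_right)
qed

lemma VF_sum_fun: "X \<in> VF \<Longrightarrow> (\<And>i. i \<in> I \<Longrightarrow> f i \<in> SF) \<Longrightarrow> X (\<Sum>i\<in>I. f i) = (\<Sum>i\<in>I. X (f i))"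
  by (induction I rule: infinite_finite_induct) (auto simp: VF_0_fun[of X] VF_add_fun[of X] SF_sum)

lemma VF_I:
  assumes "\<And>f. f \<notin> SF \<Longrightarrow> X f = 0" "\<And>f. f \<in> SF \<Longrightarrow> X f \<in> SF"
    "\<And>f h. f \<in> SF \<Longrightarrow> h \<in> SF \<Longrightarrow> X (f + h) = X f + X h"
    "\<And>f c. f \<in> SF \<Longrightarrow> X ((\<lambda>_. c) * f) = (\<lambda>_. c) * X f"
    "\<And>f h. f \<in> SF \<Longrightarrow> h \<in> SF \<Longrightarrow> X (f * h) = f * X h + h * X f"
  shows "X \<in> VF"
  unfolding vector_fields_def by (intro CollectI conjI ballI allI impI assms)

lemma VF_add [simp, intro]: "X \<in> VF \<Longrightarrow> Y \<in> VF \<Longrightarrow> X + Y \<in> VF"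
  by (rule VF_I) (simp_all add: VF_SF[of X] VF_SF[of Y] VF_nonsmooth[of X] VF_nonsmooth[of Y] VF_add_fun[of X] VF_add_fun[of Y]
      VF_scale_fun[of X] VF_scale_fun[of Y] VF_mult_fun[of X] VF_mult_fun[of Y] VF_const_fun[of X] VF_const_fun[of Y] algebra_simps)

lemma VF_0 [simp, intro]: "0 \<in> VF"
  by (rule VF_I) simp_all

lemma VF_vscale [simp, intro]: "f \<in> SF \<Longrightarrow> X \<in> VF \<Longrightarrow> f \<odot> X \<in> VF"
  by (rule VF_I) (simp_all add: vscale_def VF_SF[of X] VF_nonsmooth[of X] VF_add_fun[of X]
      VF_scale_fun[of X] VF_mult_fun[of X] VF_const_fun[of X] algebra_simps)

lemma VF_uminus [simp, intro]: "X \<in> VF \<Longrightarrow> - X \<in> VF"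
proof -
  assume "X \<in> VF"
  then have "(\<lambda>_. - 1) \<odot> X \<in> VF" by blast
  moreover have "(\<lambda>_. - 1) \<odot> X = - X" by (simp add: vscale_def fun_eq_iff)
  ultimately show ?thesis by simp
qed

lemma VF_diff [simp, intro]: "X \<in> VF \<Longrightarrow> Y \<in> VF \<Longrightarrow> X - Y \<in> VF"
  using VF_add[of X "- Y"] by simp

lemma VF_sum [intro]: "(\<And>i. i \<in> I \<Longrightarrow> X i \<in> VF) \<Longrightarrow> (\<Sum>i\<in>I. X i) \<in> VF"
  by (induction I rule: infinite_finite_induct) auto

lemma VF_lie_bracket [simp, intro]: "X \<in> VF \<Longrightarrow> Y \<in> VF \<Longrightarrow> lie_bracket X Y \<in> VF"
  by (rule VF_I)
    (simp_all add: lie_bracket_def VF_SF[of X] VF_SF[of Y] VF_0_fun[of X] VF_0_fun[of Y] VF_nonsmooth[of X] VF_nonsmooth[of Y]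
      VF_add_fun[of X] VF_add_fun[of Y] VF_scale_fun[of X] VF_scale_fun[of Y] VF_mult_fun[of X] VF_mult_fun[of Y] VF_const_fun[of X] VF_const_fun[of Y] algebra_simps)

definition chart_extension :: "'a set \<Rightarrow> ('a \<Rightarrow> 'e) \<Rightarrow> 'e set \<Rightarrow> ('e \<Rightarrow> real) \<Rightarrow> 'a \<Rightarrow> real" where
  "chart_extension U \<psi> S G q = (if q \<in> U \<and> \<psi> q \<in> S then G (\<psi> q) else 0)"

text \<open>
  Points outside the chart domain have a neighbourhood on which the extension vanishes: the preimage
  of the compact set \<open>K\<close> is compact, hence closed in the Hausdorff space.
\<close>

lemma chart_extension_smooth:
  assumes U: "(U, \<psi>) \<in> A" and S: "open S" "S \<subseteq> \<psi> ` U" and K: "compact K" "K \<subseteq> S"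
    and G: "smooth_on S G" "\<And>x. x \<in> S - K \<Longrightarrow> G x = 0"
  shows "chart_extension U \<psi> S G \<in> SF"
proof (rule SF_I)
  fix W \<psi>' k assume W: "(W, \<psi>') \<in> A"
  let ?F = "chart_extension U \<psi> S G"
  have inv: "inv_into W \<psi>' (\<psi>' q) = q" if "q \<in> W" for q
    using chart(3)[OF W] that by simp
  show "Ck_on k (\<psi>' ` W) (\<lambda>x. ?F (inv_into W \<psi>' x))"
  proof (rule Ck_on_locally[OF open_chart_image[OF W]])
    fix y assume "y \<in> \<psi>' ` W"
    then obtain q where q: "q \<in> W" "y = \<psi>' q" by auto
    show "\<exists>T. open T \<and> y \<in> T \<and> Ck_on k T (\<lambda>x. ?F (inv_into W \<psi>' x))"
    proof (cases "q \<in> U \<and> \<psi> q \<in> S")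
      case True
      define N where "N = W \<inter> (U \<inter> \<psi> -` S)"
      have "open N" unfolding N_def
        by (intro open_Int chart(1)[OF W] continuous_open_preimage[OF chart(4)[OF U] chart(1)[OF U] S(1)])
      then have oT: "open (\<psi>' ` N)"
        by (rule open_chart_image_subset[OF W]) (auto simp: N_def)
      have "Ck_on k (\<psi>' ` (W \<inter> U)) (\<lambda>x. \<psi> (inv_into W \<psi>' x))"
        using atlas U W unfolding smooth_atlas_def smooth_on_def comp_def by fastforce
      then have tr: "Ck_on k (\<psi>' ` N) (\<lambda>x. \<psi> (inv_into W \<psi>' x))"
        by (rule Ck_on_subset) (auto simp: N_def)
      have "Ck_on k (\<psi>' ` N) (\<lambda>x. G (\<psi> (inv_into W \<psi>' x)))"
        by (rule Ck_on_compose[OF oT S(1) _ tr]) (use G(1) in \<open>auto simp: smooth_on_def N_def inv\<close>)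
      then have "Ck_on k (\<psi>' ` N) (\<lambda>x. ?F (inv_into W \<psi>' x))"
        by (rule Ck_on_cong[OF oT, rotated]) (auto simp: N_def inv chart_extension_def)
      moreover have "y \<in> \<psi>' ` N" using True q by (auto simp: N_def)
      ultimately show ?thesis using oT by blast
    next
      case False
      define N where "N = W - inv_into U \<psi> ` K"
      have "compact (inv_into U \<psi> ` K)"
        by (rule compact_continuous_image[OF continuous_on_subset[OF chart(5)[OF U]] K(1)]) (use K S in auto)
      then have "open N" unfolding N_def using chart(1)[OF W] compact_imp_closed by blast
      then have oT: "open (\<psi>' ` N)"
        by (rule open_chart_image_subset[OF W]) (auto simp: N_def)
      have "?F r = 0" if "r \<in> N" for r
      proof (cases "r \<in> U \<and> \<psi> r \<in> S")
        case True
        then have "r = inv_into U \<psi> (\<psi> r)" using chart(3)[OF U] by simp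
        then have "\<psi> r \<notin> K" using that unfolding N_def by blast
        then show ?thesis using G(2) True by (auto simp: chart_extension_def)
      qed (auto simp: chart_extension_def)
      then have "Ck_on k (\<psi>' ` N) (\<lambda>x. ?F (inv_into W \<psi>' x))"
        by (intro Ck_on_cong[OF oT _ Ck_on_const[OF oT, of _ 0]]) (auto simp: N_def inv)
      moreover have "y \<in> \<psi>' ` N"
      proof -
        have "q \<notin> inv_into U \<psi> ` K"
        proof
          assume "q \<in> inv_into U \<psi> ` K"
          then obtain x where x: "x \<in> K" "q = inv_into U \<psi> x" by auto
          then have "x \<in> \<psi> ` U" using K S by auto
          then have "q \<in> U" "\<psi> q = x" by (simp_all add: x inv_into_into f_inv_into_f)
          then show False using False x K by auto
        qed
        then show ?thesis using q by (auto simp: N_def)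
      qed
      ultimately show ?thesis using oT by blast
    qed
  qed
qed

text \<open>
  At a point \<open>q\<close> of the chart with coordinate vector \<open>y0\<close>, Hadamard's lemma writes
  \<open>\<kappa>\<^sup>2 (f - f q)\<close> as a sum of products of \<open>x b - k b \<kappa>\<close> with cut-off functions, where \<open>k\<close> is the
  displacement of \<open>y0\<close> from the centre.  The first factors vanish at \<open>q\<close>, so applying \<open>X\<close> leaves only
  their derivatives.  A further factor \<open>\<kappa>\<close> turns \<open>k b\<close>, which depends on \<open>q\<close>, into the smooth
  function \<open>x b\<close>; this is why \<open>\<kappa>\<close> occurs in the third power.
\<close>

lemma coordinate_frame:
  obtains \<kappa> x E where "\<kappa> \<in> SF" "\<kappa> p = 1"
    and "\<And>b. b \<in> Basis \<Longrightarrow> x b \<in> SF \<and> x b p = 0"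
    and "\<And>b. b \<in> Basis \<Longrightarrow> E b \<in> VF"
    and "\<And>b b'::'e. b \<in> Basis \<Longrightarrow> b' \<in> Basis \<Longrightarrow> E b (x b') p = (if b = b' then 1 else 0)"
    and "\<And>X. X \<in> VF \<Longrightarrow> (\<kappa> * \<kappa> * \<kappa>) \<odot> X = (\<Sum>b\<in>Basis. (\<kappa> * X (x b) - x b * X \<kappa>) \<odot> E b)"
proof -
  have "p \<in> (\<Union>c\<in>A. fst c)" using atlas by (simp add: smooth_atlas_def)
  then obtain U \<psi> where U: "(U, \<psi>) \<in> A" and p: "p \<in> U" by force
  define c where "c = \<psi> p"
  obtain R where R: "R > 0" "ball c R \<subseteq> \<psi> ` U"
    using open_chart_image[OF U] p unfolding c_def by (meson imageI open_contains_ball)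
  define S where "S = ball c R"
  have S: "open S" "convex S" "S \<subseteq> \<psi> ` U" "c \<in> S" using R by (auto simp: S_def)
  obtain \<beta> :: "'e \<Rightarrow> real" where \<beta>: "smooth_on UNIV \<beta>" "\<And>y. dist c y \<ge> R / 2 \<Longrightarrow> \<beta> y = 0" "\<beta> c = 1"
    using ball_bump_exists[of "R / 2" c] R by auto
  have \<beta>S: "Ck_on k S \<beta>" for k
    using \<beta>(1) Ck_on_subset unfolding smooth_on_def by blast
  define ext where "ext G = chart_extension U \<psi> S (\<lambda>y. \<beta> y * G y)" for G
  have ext_SF: "ext G \<in> SF" if "\<And>k. Ck_on k S G" for G
    unfolding ext_def
  proof (rule chart_extension_smooth[OF U S(1,3)])
    show "compact (cball c (R / 2))" "cball c (R / 2) \<subseteq> S" using R by (auto simp: S_def)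
    show "smooth_on S (\<lambda>y. \<beta> y * G y)"
      unfolding smooth_on_def using Ck_on_mult[OF S(1) \<beta>S that] by blast
    show "\<beta> y * G y = 0" if "y \<in> S - cball c (R / 2)" for y
      using that \<beta>(2)[of y] by auto
  qed
  have ext_in: "ext G q = \<beta> (\<psi> q) * G (\<psi> q)" if "q \<in> U" "\<psi> q \<in> S" for G q
    using that by (simp add: ext_def chart_extension_def)
  have ext_out: "ext G q = 0" if "\<not> (q \<in> U \<and> \<psi> q \<in> S)" for G q
    using that by (auto simp: ext_def chart_extension_def)
  define loc :: "('a \<Rightarrow> real) \<Rightarrow> 'e \<Rightarrow> real" where "loc f y = f (inv_into U \<psi> y)" for f y
  have inv: "inv_into U \<psi> (\<psi> q) = q" if "q \<in> U" for q
    using that chart(3)[OF U] by simp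
  have S_cases: "\<exists>q\<in>U. \<psi> q = y" if "y \<in> S" for y using that S(3) by auto
  have loc: "Ck_on k S (loc f)" if "f \<in> SF" for f k
    using SF_Ck_on[OF that U] Ck_on_subset[OF _ S(3)] unfolding loc_def by blast
  define d where "d b f y = frechet_derivative (loc f) (at y) b" for b f y
  have locd: "(loc f has_derivative frechet_derivative (loc f) (at y)) (at y)" if "f \<in> SF" "y \<in> S" for f y
    using Ck_on_Suc_deriv[OF loc[OF that(1)] S(1) that(2)] .
  have dI: "d b f y = D b" if "(loc f has_derivative D) (at y)" for f y D b
    unfolding d_def using frechet_derivative_at[OF that] by simp
  have d_Ck: "Ck_on k S (d b f)" if "f \<in> SF" for f b k
    using loc[OF that, of "Suc k"] unfolding d_def by simp
  have d_add: "d b (f + h) y = d b f y + d b h y" if "f \<in> SF" "h \<in> SF" "y \<in> S" for f h y b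
  proof -
    have "loc (f + h) = (\<lambda>y. loc f y + loc h y)" by (simp add: loc_def fun_eq_iff)
    with dI[of "f + h"] has_derivative_add[OF locd[OF that(1,3)] locd[OF that(2,3)]]
    show ?thesis by (simp add: d_def)
  qed
  have d_mult: "d b (f * h) y = loc f y * d b h y + d b f y * loc h y"
    if "f \<in> SF" "h \<in> SF" "y \<in> S" for f h y b
  proof -
    have "loc (f * h) = (\<lambda>y. loc f y * loc h y)" by (simp add: loc_def fun_eq_iff)
    with dI[of "f * h"] has_derivative_mult[OF locd[OF that(1,3)] locd[OF that(2,3)]]
    show ?thesis by (simp add: d_def)
  qed
  have d_const: "d b (\<lambda>_. k) y = 0" for k b y
  proof -
    have "loc (\<lambda>_. k) = (\<lambda>_. k)" by (simp add: loc_def fun_eq_iff)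
    then show ?thesis using dI[of "\<lambda>_. k" "\<lambda>_. 0" y b] by simp
  qed
  define \<kappa> where "\<kappa> = ext (\<lambda>_. 1)"
  define x where "x b = ext (\<lambda>y. (y - c) \<bullet> b)" for b
  define E where "E b f = (if f \<in> SF then ext (d b f) else 0)" for b f
  have lin: "Ck_on k S (\<lambda>y. (y - c) \<bullet> b)" for k b
    using Ck_on_add[OF S(1) Ck_on_linear[OF S(1) bounded_linear_inner_left[of b]]
        Ck_on_const[OF S(1)], of k "- c \<bullet> b"] by (simp add: inner_diff_left)
  have \<kappa>: "\<kappa> \<in> SF" unfolding \<kappa>_def by (rule ext_SF) (rule Ck_on_const[OF S(1)])
  have x: "x b \<in> SF" for b unfolding x_def by (rule ext_SF) (rule lin)
  have x_\<kappa>: "x b q = ((\<psi> q - c) \<bullet> b) * \<kappa> q" for b q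
    using ext_in ext_out unfolding x_def \<kappa>_def by (cases "q \<in> U \<and> \<psi> q \<in> S") auto
  have E: "E b \<in> VF" for b
  proof (rule VF_I)
    show "E b f = 0" if "f \<notin> SF" for f using that by (simp add: E_def)
    show "E b f \<in> SF" if "f \<in> SF" for f
      using that d_Ck by (auto simp: E_def intro: ext_SF)
    have ext_eqI: "ext G = F" if "\<And>q. q \<in> U \<Longrightarrow> \<psi> q \<in> S \<Longrightarrow> \<beta> (\<psi> q) * G (\<psi> q) = F q"
      "\<And>q. \<not> (q \<in> U \<and> \<psi> q \<in> S) \<Longrightarrow> F q = 0" for G F
    proof
      fix q show "ext G q = F q"
        using that ext_in ext_out by (cases "q \<in> U \<and> \<psi> q \<in> S") auto
    qed
    fix f k assume f: "f \<in> SF"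
    show "E b (f + h) = E b f + E b h" if h: "h \<in> SF" for h
      unfolding E_def using f h
      by (simp, intro ext_eqI) (auto simp: ext_in ext_out d_add[OF f h] algebra_simps)
    have mult: "E b (f * h) = f * E b h + h * E b f" if h: "h \<in> SF" for h
      unfolding E_def using f h
      by (simp, intro ext_eqI) (auto simp: ext_in ext_out d_mult[OF f h] loc_def inv algebra_simps)
    then show "E b (f * h) = f * E b h + h * E b f" if h: "h \<in> SF" for h using h .
    have "E b (\<lambda>_. k) = 0"
      unfolding E_def by (simp, intro ext_eqI) (auto simp: d_const)
    then show "E b ((\<lambda>_. k) * f) = (\<lambda>_. k) * E b f"
      using mult[of "\<lambda>_. k"] by (simp add: mult.commute)
  qed
  show thesis
  proof (rule that[of \<kappa> x E])
    show "\<kappa> p = 1" using ext_in[OF p] S(4) \<beta>(3) by (simp add: \<kappa>_def c_def)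
    show "x b \<in> SF \<and> x b p = 0" for b using x x_\<kappa> by (simp add: c_def)
    fix b b' :: 'e assume b: "b \<in> Basis" "b' \<in> Basis"
    let ?\<beta>' = "frechet_derivative \<beta> (at c)"
    have "(\<beta> has_derivative ?\<beta>') (at c)" using Ck_on_Suc_deriv[OF \<beta>S S(1,4)] .
    then have "((\<lambda>y. \<beta> y * ((y - c) \<bullet> b')) has_derivative (\<lambda>v. v \<bullet> b')) (at c)"
      by (auto intro!: derivative_eq_intros simp: \<beta>(3))
    then have "(loc (x b') has_derivative (\<lambda>v. v \<bullet> b')) (at c)"
    proof (rule has_derivative_transform_within_open[OF _ S(1,4)])
      fix y assume "y \<in> S"
      then obtain q where "q \<in> U" "\<psi> q = y" "y \<in> S" using S_cases by blast
      then show "\<beta> y * ((y - c) \<bullet> b') = loc (x b') y"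
        using inv ext_in[of q] by (auto simp: loc_def x_def)
    qed
    then have "d b (x b') c = b \<bullet> b'" by (rule dI)
    then show "E b (x b') p = (if b = b' then 1 else 0)"
      using b x ext_in[OF p] S(4) \<beta>(3) by (simp add: E_def c_def inner_Basis)
  next
    fix X assume X: "X \<in> VF"
    show "(\<kappa> * \<kappa> * \<kappa>) \<odot> X = (\<Sum>b\<in>Basis. (\<kappa> * X (x b) - x b * X \<kappa>) \<odot> E b)"
    proof (intro ext)
      fix f q
      have goal: "\<kappa> q ^ 3 * X f q = (\<Sum>b\<in>Basis. (\<kappa> q * X (x b) q - x b q * X \<kappa> q) * E b f q)"
      proof (cases "f \<in> SF \<and> q \<in> U \<and> \<psi> q \<in> S")
        case False
        then consider "f \<notin> SF" | "\<not> (q \<in> U \<and> \<psi> q \<in> S)" by blast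
        then show ?thesis
        proof cases
          case 1
          then show ?thesis using VF_nonsmooth[OF X] by (simp add: E_def)
        next
          case 2
          then show ?thesis using ext_out by (simp add: x_\<kappa> \<kappa>_def)
        qed
      next
        case True
        then have f: "f \<in> SF" and q: "q \<in> U" "\<psi> q \<in> S" by auto
        define y0 where "y0 = \<psi> q"
        have "smooth_on S (loc f)" using loc[OF f] by (simp add: smooth_on_def)
        then obtain h where h: "\<And>b. smooth_on S (h b)"
          "\<And>y. y \<in> S \<Longrightarrow> loc f y = loc f y0 + (\<Sum>b\<in>Basis. ((y - y0) \<bullet> b) * h b y)"
          "\<And>b. h b y0 = d b f y0"
          using Hadamard_lemma[OF S(1,2) q(2)] unfolding d_def y0_def by metis
        have H: "ext (h b) \<in> SF" for b using h(1) by (intro ext_SF) (simp add: smooth_on_def)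
        define k where "k b = (y0 - c) \<bullet> b" for b
        \<comment> \<open>Hadamard's lemma, transported to the manifold\<close>
        have dec: "\<kappa> * \<kappa> * (f - (\<lambda>_. f q)) = (\<Sum>b\<in>Basis. (x b - (\<lambda>_. k b) * \<kappa>) * ext (h b))"
        proof
          fix r
          show "(\<kappa> * \<kappa> * (f - (\<lambda>_. f q))) r = (\<Sum>b\<in>Basis. (x b - (\<lambda>_. k b) * \<kappa>) * ext (h b)) r"
          proof (cases "r \<in> U \<and> \<psi> r \<in> S")
            case True
            then have "f r - f q = (\<Sum>b\<in>Basis. ((\<psi> r - y0) \<bullet> b) * h b (\<psi> r))"
              using h(2)[of "\<psi> r"] inv q by (simp add: loc_def y0_def)
            then show ?thesis using True
              by (simp add: sum_fun_apply x_\<kappa> \<kappa>_def ext_in k_def sum_distrib_left inner_diff_left algebra_simps)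
          next
            case False
            then show ?thesis using ext_out by (simp add: sum_fun_apply \<kappa>_def)
          qed
        qed
        have "X (\<kappa> * \<kappa> * (f - (\<lambda>_. f q))) q = \<kappa> q * \<kappa> q * X f q"
          by (simp add: VF_mult_fun[OF X] VF_diff_fun[OF X] VF_const_fun[OF X] \<kappa> f)
        moreover have "X (\<Sum>b\<in>Basis. (x b - (\<lambda>_. k b) * \<kappa>) * ext (h b)) q
            = (\<Sum>b\<in>Basis. (X (x b) q - k b * X \<kappa> q) * E b f q)"
        proof -
          have "X ((x b - (\<lambda>_. k b) * \<kappa>) * ext (h b)) q = (X (x b) q - k b * X \<kappa> q) * E b f q" for b
          proof -
            have "x b q - k b * \<kappa> q = 0" by (simp add: x_\<kappa> k_def y0_def)
            moreover have "ext (h b) q = E b f q"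
              using f q h(3)[of b] by (simp add: E_def ext_in y0_def)
            ultimately show ?thesis
              by (simp add: VF_mult_fun[OF X] VF_diff_fun[OF X] VF_const_fun[OF X] \<kappa> x H mult.commute)
          qed
          then show ?thesis
            by (subst VF_sum_fun[OF X]) (auto simp: \<kappa> x H sum_fun_apply)
        qed
        ultimately have "\<kappa> q * \<kappa> q * X f q = (\<Sum>b\<in>Basis. (X (x b) q - k b * X \<kappa> q) * E b f q)"
          using dec by simp
        then have "\<kappa> q * (\<kappa> q * \<kappa> q * X f q) = (\<Sum>b\<in>Basis. \<kappa> q * ((X (x b) q - k b * X \<kappa> q) * E b f q))"
          by (simp only: sum_distrib_left)
        moreover have "\<kappa> q * ((X (x b) q - k b * X \<kappa> q) * E b f q)
            = (\<kappa> q * X (x b) q - x b q * X \<kappa> q) * E b f q" for b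
          by (simp add: x_\<kappa> k_def y0_def algebra_simps)
        ultimately show ?thesis by (simp add: power3_eq_cube mult.assoc)
      qed
      then show "((\<kappa> * \<kappa> * \<kappa>) \<odot> X) f q = (\<Sum>b\<in>Basis. (\<kappa> * X (x b) - x b * X \<kappa>) \<odot> E b) f q"
        by (simp add: vscale_def sum_fun_apply power3_eq_cube mult.assoc)
    qed
  qed (use \<kappa> E in auto)
qed

lemma one_form_add: "one_form A \<theta> \<Longrightarrow> X \<in> VF \<Longrightarrow> Y \<in> VF \<Longrightarrow> \<theta> (X + Y) = \<theta> X + \<theta> Y"
  and one_form_vscale: "one_form A \<theta> \<Longrightarrow> f \<in> SF \<Longrightarrow> X \<in> VF \<Longrightarrow> \<theta> (f \<odot> X) = f * \<theta> X"
  and one_form_SF: "one_form A \<theta> \<Longrightarrow> X \<in> VF \<Longrightarrow> \<theta> X \<in> SF"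
  by (auto simp: one_form_def)

lemma one_form_0:
  assumes \<theta>: "one_form A \<theta>"
  shows "\<theta> 0 = 0"
  using one_form_add[OF \<theta> VF_0 VF_0] by simp

lemma one_form_sum:
  assumes \<theta>: "one_form A \<theta>" and "\<And>i. i \<in> I \<Longrightarrow> X i \<in> VF"
  shows "\<theta> (\<Sum>i\<in>I. X i) = (\<Sum>i\<in>I. \<theta> (X i))"
  using assms(2)
  by (induction I rule: infinite_finite_induct) (auto simp: one_form_0[OF \<theta>] one_form_add[OF \<theta>] VF_sum)

text \<open>
  At \<open>p\<close>, where \<open>\<kappa> = 1\<close> and \<open>x b = 0\<close>, the identity of \<open>coordinate_frame\<close> gives the components of
  \<open>X\<close> in the frame \<open>E\<close> as \<open>X (x b) p\<close>; a one-form sees \<open>X\<close> at \<open>p\<close> only through them.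
\<close>

lemma tangent_coordinates:
  obtains x E where
    "\<And>b::'e. b \<in> Basis \<Longrightarrow> E b \<in> VF"
    and "\<And>b b'. b \<in> Basis \<Longrightarrow> b' \<in> Basis \<Longrightarrow> E b (x b') p = (if b = b' then 1 else 0)"
    and "\<And>X \<theta>. X \<in> VF \<Longrightarrow> one_form A \<theta> \<Longrightarrow> \<theta> X p = (\<Sum>b\<in>Basis. X (x b) p * \<theta> (E b) p)"
proof -
  obtain \<kappa> x E where \<kappa>: "\<kappa> \<in> SF" "\<kappa> p = 1"
    and x: "\<And>b::'e. b \<in> Basis \<Longrightarrow> x b \<in> SF \<and> x b p = 0"
    and E: "\<And>b. b \<in> Basis \<Longrightarrow> E b \<in> VF"
    and dual: "\<And>b b'::'e. b \<in> Basis \<Longrightarrow> b' \<in> Basis \<Longrightarrow> E b (x b') p = (if b = b' then 1 else 0)"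
    and X: "\<And>X. X \<in> VF \<Longrightarrow> (\<kappa> * \<kappa> * \<kappa>) \<odot> X = (\<Sum>b\<in>Basis. (\<kappa> * X (x b) - x b * X \<kappa>) \<odot> E b)"
    by (rule coordinate_frame) blast
  have "\<theta> X p = (\<Sum>b\<in>Basis. X (x b) p * \<theta> (E b) p)" if XV: "X \<in> VF" and \<theta>: "one_form A \<theta>" for X \<theta>
  proof -
    have co: "\<kappa> * X (x b) - x b * X \<kappa> \<in> SF" if "b \<in> Basis" for b
      using that x VF_SF[OF XV] \<kappa> by auto
    have "\<theta> ((\<kappa> * \<kappa> * \<kappa>) \<odot> X) p = \<theta> (\<Sum>b\<in>Basis. (\<kappa> * X (x b) - x b * X \<kappa>) \<odot> E b) p"
      using X[OF XV] by simp
    also have "\<dots> = (\<Sum>b\<in>Basis. ((\<kappa> * X (x b) - x b * X \<kappa>) * \<theta> (E b)) p)"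
      using co E by (simp add: one_form_sum[OF \<theta>] sum_fun_apply one_form_vscale[OF \<theta>] del: times_fun_apply minus_apply)
    finally show ?thesis using \<kappa> x XV by (simp add: one_form_vscale[OF \<theta>])
  qed
  with that[of E x] E dual show thesis by blast
qed

end

section \<open>Orthonormal frames, traces and connections\<close>

context smooth_manifold
begin

lemma tensor_02_left: "tensor_02 A B \<Longrightarrow> Y \<in> VF \<Longrightarrow> one_form A (\<lambda>X. B X Y)"
  by (simp add: tensor_02_def)

lemma metric_tensor: "riemannian_metric A g \<Longrightarrow> tensor_02 A g"
  and metric_sym: "riemannian_metric A g \<Longrightarrow> X \<in> VF \<Longrightarrow> Y \<in> VF \<Longrightarrow> g X Y = g Y X"
  and metric_pos: "riemannian_metric A g \<Longrightarrow> X \<in> VF \<Longrightarrow> \<not> vanishes_at X p \<Longrightarrow> g X X p > 0"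
  by (auto simp: riemannian_metric_def)

lemma one_form_uminus:
  assumes \<theta>: "one_form A \<theta>" and X: "X \<in> VF"
  shows "\<theta> (- X) = - \<theta> X"
  using one_form_add[OF \<theta> X VF_uminus[OF X]] one_form_0[OF \<theta>] by (simp add: eq_neg_iff_add_eq_0 add.commute)

lemma one_form_diff:
  assumes \<theta>: "one_form A \<theta>" and "X \<in> VF" "Y \<in> VF"
  shows "\<theta> (X - Y) = \<theta> X - \<theta> Y"
  using one_form_add[OF \<theta> \<open>X \<in> VF\<close> VF_uminus[OF \<open>Y \<in> VF\<close>]] one_form_uminus[OF \<theta> \<open>Y \<in> VF\<close>] by simp

lemma one_form_lincomb:
  assumes \<theta>: "one_form A \<theta>" and F: "\<And>i. i \<in> I \<Longrightarrow> F i \<in> VF"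
  shows "\<theta> (\<Sum>i\<in>I. (\<lambda>_. c i) \<odot> F i) p = (\<Sum>i\<in>I. c i * \<theta> (F i) p)"
  using F by (simp add: one_form_sum[OF \<theta>] sum_fun_apply one_form_vscale[OF \<theta>])

text \<open>
  Gram-Schmidt with constant coefficients.  As long as there are fewer than \<open>DIM('e)\<close> fields, some
  coordinate vector \<open>u\<close> lies outside the span of the coordinate vectors \<open>T (F i)\<close>.
\<close>

lemma orthonormal_family_exists:
  assumes g: "riemannian_metric A g" and "k \<le> DIM('e)"
  shows "\<exists>F. (\<forall>i<k. F i \<in> VF) \<and> (\<forall>i<k. \<forall>j<k. g (F i) (F j) p = (if i = j then 1 else 0))"
  using assms(2)
proof (induction k)
  case (Suc k)
  then obtain F where F: "\<And>i. i < k \<Longrightarrow> F i \<in> VF"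
    and orth: "\<And>i j. i < k \<Longrightarrow> j < k \<Longrightarrow> g (F i) (F j) p = (if i = j then 1 else 0)" by auto
  obtain x E where E: "\<And>b::'e. b \<in> Basis \<Longrightarrow> E b \<in> VF"
    and dual: "\<And>b b'. b \<in> Basis \<Longrightarrow> b' \<in> Basis \<Longrightarrow> E b (x b') p = (if b = b' then 1 else 0)"
    by (rule tangent_coordinates) blast
  define T where "T X = (\<Sum>b\<in>Basis. X (x b) p *\<^sub>R b)" for X :: "'a vfield"
  have T_inner: "T X \<bullet> b = X (x b) p" if "b \<in> Basis" for X b
    using that by (simp add: T_def inner_sum_left inner_Basis if_distrib sum.delta cong: if_cong)
  have "span ((\<lambda>i. T (F i)) ` {..<k}) \<noteq> UNIV"
  proof
    assume "span ((\<lambda>i. T (F i)) ` {..<k}) = UNIV"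
    then have "DIM('e) = dim ((\<lambda>i. T (F i)) ` {..<k})" by (metis dim_span dim_UNIV)
    also have "\<dots> \<le> card ((\<lambda>i. T (F i)) ` {..<k})" by (rule dim_le_card') simp
    also have "\<dots> \<le> k" using card_image_le[of "{..<k}"] by simp
    finally show False using Suc.prems by simp
  qed
  then obtain u where u: "u \<notin> span ((\<lambda>i. T (F i)) ` {..<k})" by blast
  define X where "X = (\<Sum>b\<in>Basis. (\<lambda>_. u \<bullet> b) \<odot> E b)"
  define c where "c i = g X (F i) p" for i
  define Y where "Y = X - (\<Sum>i<k. (\<lambda>_. c i) \<odot> F i)"
  have X: "X \<in> VF" unfolding X_def using E by (intro VF_sum) auto
  have SV: "(\<Sum>i<k. (\<lambda>_. c i) \<odot> F i) \<in> VF" using F by (intro VF_sum) auto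
  have Y: "Y \<in> VF" unfolding Y_def using X SV by blast
  have "T X = u"
  proof (rule euclidean_eqI)
    fix b :: 'e assume b: "b \<in> Basis"
    have "T X \<bullet> b = (\<Sum>b'\<in>Basis. (u \<bullet> b') * E b' (x b) p)"
      using T_inner[OF b] by (simp add: X_def sum_fun_apply vscale_def)
    also have "\<dots> = (\<Sum>b'\<in>Basis. if b' = b then u \<bullet> b' else 0)"
      using b dual by (intro sum.cong) auto
    finally show "T X \<bullet> b = u \<bullet> b" using b by simp
  qed
  moreover have "T (\<Sum>i<k. (\<lambda>_. c i) \<odot> F i) = (\<Sum>i<k. c i *\<^sub>R T (F i))"
    by (rule euclidean_eqI) (simp add: T_inner inner_sum_left sum_fun_apply vscale_def)
  moreover have "(\<Sum>i<k. c i *\<^sub>R T (F i)) \<in> span ((\<lambda>i. T (F i)) ` {..<k})"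
    by (intro span_sum span_scale span_base) auto
  moreover have "T Y = T X - T (\<Sum>i<k. (\<lambda>_. c i) \<odot> F i)"
    by (rule euclidean_eqI) (simp add: T_inner inner_diff_left Y_def)
  ultimately have "T Y \<noteq> 0" using u by auto
  then have "\<not> vanishes_at Y p" unfolding vanishes_at_def T_def
    by (metis (mono_tags, lifting) scale_zero_left sum.neutral)
  then have pos: "g Y Y p > 0" using metric_pos[OF g Y] by blast
  have gY: "g Y (F j) p = 0" if j: "j < k" for j
  proof -
    have \<theta>: "one_form A (\<lambda>X. g X (F j))" by (rule tensor_02_left[OF metric_tensor[OF g] F[OF j]])
    have "g Y (F j) p = c j - (\<Sum>i<k. c i * g (F i) (F j) p)"
      unfolding Y_def one_form_diff[OF \<theta> X SV] using one_form_lincomb[OF \<theta>, of "{..<k}" F c p] F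
      by (simp add: c_def)
    also have "(\<Sum>i<k. c i * g (F i) (F j) p) = (\<Sum>i<k. if i = j then c i else 0)"
      using orth j by (intro sum.cong) auto
    finally show ?thesis using j by simp
  qed
  define s where "s = 1 / sqrt (g Y Y p)"
  define Z where "Z = (\<lambda>_. s) \<odot> Y"
  have Z: "Z \<in> VF" using Y by (auto simp: Z_def)
  have gZ: "g Z W p = s * g Y W p" if "W \<in> VF" for W
    using one_form_vscale[OF tensor_02_left[OF metric_tensor[OF g] that] SF_const Y, of s] by (simp add: Z_def)
  have ZF: "g Z (F j) p = 0" "g (F j) Z p = 0" if "j < k" for j
    using gZ[OF F[OF that]] gY[OF that] metric_sym[OF g Z F[OF that]] by simp_all
  have "g Y Z p = s * g Y Y p"
    using gZ[OF Y] metric_sym[OF g Y Z] by simp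
  then have "g Z Z p = 1" using gZ[OF Z] pos by (simp add: s_def)
  then have "(\<forall>i<Suc k. (F(k := Z)) i \<in> VF) \<and>
      (\<forall>i<Suc k. \<forall>j<Suc k. g ((F(k := Z)) i) ((F(k := Z)) j) p = (if i = j then 1 else 0))"
    using F Z orth ZF by (auto simp: less_Suc_eq)
  then show ?case by blast
qed simp

lemma orthonormal_at_exists: "riemannian_metric A g \<Longrightarrow> \<exists>E. orthonormal_at A g p E"
  using orthonormal_family_exists[of g "DIM('e)" p] by (auto simp: orthonormal_at_def)

text \<open>
  Pairing with the \<open>F j\<close> shows that the coordinate vectors \<open>T (F i)\<close> are independent.  There are
  \<open>DIM('e)\<close> of them, so \<open>T X\<close> is a combination of them, with coefficients \<open>g X (F i) p\<close>.
\<close>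

lemma orthonormal_expansion:
  assumes g: "riemannian_metric A g" and F: "orthonormal_at A g p F"
    and X: "X \<in> VF" and \<theta>: "one_form A \<theta>"
  shows "\<theta> X p = (\<Sum>i<DIM('e). g X (F i) p * \<theta> (F i) p)"
proof -
  let ?m = "DIM('e)"
  have FV: "F i \<in> VF" if "i < ?m" for i using F that by (auto simp: orthonormal_at_def)
  have orth: "g (F i) (F j) p = (if i = j then 1 else 0)" if "i < ?m" "j < ?m" for i j
    using F that by (auto simp: orthonormal_at_def)
  obtain x E where E: "\<And>b::'e. b \<in> Basis \<Longrightarrow> E b \<in> VF"
    and coords: "\<And>X \<theta>. X \<in> VF \<Longrightarrow> one_form A \<theta> \<Longrightarrow> \<theta> X p = (\<Sum>b\<in>Basis. X (x b) p * \<theta> (E b) p)"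
    by (rule tangent_coordinates) blast
  define T where "T X = (\<Sum>b\<in>Basis. X (x b) p *\<^sub>R b)" for X :: "'a vfield"
  \<comment> \<open>the functional on coordinate vectors that \<open>\<theta>\<close> induces at \<open>p\<close>\<close>
  define L where "L \<theta> v = (\<Sum>b\<in>Basis. (v \<bullet> b) * \<theta> (E b) p)" for \<theta> :: "'a vfield \<Rightarrow> 'a \<Rightarrow> real" and v :: 'e
  have T_inner: "T X \<bullet> b = X (x b) p" if "b \<in> Basis" for X b
    using that by (simp add: T_def inner_sum_left inner_Basis if_distrib sum.delta cong: if_cong)
  have LT: "\<theta> X p = L \<theta> (T X)" if "X \<in> VF" "one_form A \<theta>" for X \<theta>
    using coords[OF that] by (simp add: L_def T_inner)
  have lin: "linear (L \<theta>)" for \<theta>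
    by (rule linearI) (simp_all add: L_def inner_add_left algebra_simps sum.distrib sum_distrib_left)
  have L_comb: "L \<theta> (\<Sum>i<?m. a i *\<^sub>R T (F i)) = (\<Sum>i<?m. a i * \<theta> (F i) p)" if "one_form A \<theta>" for a \<theta>
    using FV LT[OF _ that] by (simp add: linear_sum[OF lin] linear_scale[OF lin])
  have gF: "one_form A (\<lambda>X. g X (F j))" if "j < ?m" for j
    by (rule tensor_02_left[OF metric_tensor[OF g] FV[OF that]])
  have coeff: "L (\<lambda>X. g X (F j)) (\<Sum>i<?m. a i *\<^sub>R T (F i)) = a j" if "j < ?m" for a j
  proof -
    have "(\<Sum>i<?m. a i * g (F i) (F j) p) = (\<Sum>i<?m. if i = j then a i else 0)"
      using orth that by (intro sum.cong) auto
    then show ?thesis using that L_comb[OF gF[OF that], of a] by simp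
  qed
  have inj: "inj_on (\<lambda>i. T (F i)) {..<?m}"
  proof (rule inj_onI)
    fix i j assume ij: "i \<in> {..<?m}" "j \<in> {..<?m}" "T (F i) = T (F j)"
    then have "g (F i) (F j) p = g (F j) (F j) p" using LT[OF FV gF] by simp
    then show "i = j" using ij orth by (auto split: if_splits)
  qed
  have "independent ((\<lambda>i. T (F i)) ` {..<?m})"
  proof (rule independent_if_scalars_zero)
    fix f v assume f: "(\<Sum>v\<in>(\<lambda>i. T (F i)) ` {..<?m}. f v *\<^sub>R v) = 0" and v: "v \<in> (\<lambda>i. T (F i)) ` {..<?m}"
    then obtain j where j: "j < ?m" "v = T (F j)" by auto
    have "(\<Sum>i<?m. f (T (F i)) *\<^sub>R T (F i)) = 0" using f by (simp add: sum.reindex[OF inj])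
    then show "f v = 0" using coeff[OF j(1), of "\<lambda>i. f (T (F i))"] j linear_0[OF lin] by simp
  qed simp
  moreover have "card ((\<lambda>i. T (F i)) ` {..<?m}) = ?m" by (simp add: card_image[OF inj])
  ultimately have "UNIV \<subseteq> span ((\<lambda>i. T (F i)) ` {..<?m})"
    by (intro card_ge_dim_independent) auto
  then have "T X \<in> range (\<lambda>f. \<Sum>v\<in>(\<lambda>i. T (F i)) ` {..<?m}. f v *\<^sub>R v)"
    using span_finite[of "(\<lambda>i. T (F i)) ` {..<?m}"] by auto
  then obtain f where "T X = (\<Sum>v\<in>(\<lambda>i. T (F i)) ` {..<?m}. f v *\<^sub>R v)" by blast
  then have TX: "T X = (\<Sum>i<?m. f (T (F i)) *\<^sub>R T (F i))" by (simp add: sum.reindex[OF inj])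
  have "g X (F j) p = f (T (F j))" if "j < ?m" for j
    using coeff[OF that, of "\<lambda>i. f (T (F i))"] LT[OF X gF[OF that]] TX by simp
  then show ?thesis using LT[OF X \<theta>] TX L_comb[OF \<theta>, of "\<lambda>i. f (T (F i))"] by simp
qed

lemma metric_trace_frame:
  assumes "riemannian_metric A g"
  obtains E where "orthonormal_at A g p E"
    "\<And>B. metric_trace A g B p = (\<Sum>i<DIM('e). B (E i) (E i) p)"
proof (rule that)
  show "orthonormal_at A g p (SOME E. orthonormal_at A g p E)"
    using orthonormal_at_exists[OF assms] by (rule someI_ex)
qed (simp add: metric_trace_def Let_def)

lemma tensor_11_one_form:
  assumes T: "tensor_11 A T" and \<theta>: "one_form A \<theta>"
  shows "one_form A (\<lambda>X. \<theta> (T X))"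
  using T one_form_SF[OF \<theta>] one_form_add[OF \<theta>] one_form_vscale[OF \<theta>]
  unfolding tensor_11_def one_form_def[of A "\<lambda>X. \<theta> (T X)"] by simp

text \<open>
  Expand \<open>T (E i)\<close> in the second frame, exchange the sums, and contract over the first frame.
\<close>

lemma trace_metric_independent:
  assumes g: "riemannian_metric A g" and h: "riemannian_metric A h" and T: "tensor_11 A T"
  shows "metric_trace A g (\<lambda>Z W. g (T Z) W) p = metric_trace A h (\<lambda>Z W. h (T Z) W) p"
proof -
  obtain E where E: "orthonormal_at A g p E"
    and trE: "\<And>B. metric_trace A g B p = (\<Sum>i<DIM('e). B (E i) (E i) p)"
    using metric_trace_frame[OF g] by blast
  obtain F where F: "orthonormal_at A h p F"
    and trF: "\<And>B. metric_trace A h B p = (\<Sum>i<DIM('e). B (F i) (F i) p)"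
    using metric_trace_frame[OF h] by blast
  have EV: "E i \<in> VF" and FV: "F i \<in> VF" if "i < DIM('e)" for i
    using E F that by (auto simp: orthonormal_at_def)
  have TV: "T X \<in> VF" if "X \<in> VF" for X using T that by (auto simp: tensor_11_def)
  have "(\<Sum>i<DIM('e). g (T (E i)) (E i) p)
      = (\<Sum>i<DIM('e). \<Sum>j<DIM('e). h (T (E i)) (F j) p * g (F j) (E i) p)"
    using EV TV by (intro sum.cong refl orthonormal_expansion[OF h F _ tensor_02_left[OF metric_tensor[OF g]]]) auto
  also have "\<dots> = (\<Sum>j<DIM('e). \<Sum>i<DIM('e). g (F j) (E i) p * h (T (E i)) (F j) p)"
    by (subst sum.swap) (simp add: mult.commute)
  also have "\<dots> = (\<Sum>j<DIM('e). h (T (F j)) (F j) p)"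
    using FV by (intro sum.cong refl orthonormal_expansion[OF g E, symmetric]
        tensor_11_one_form[OF T tensor_02_left[OF metric_tensor[OF h]]]) auto
  finally show ?thesis by (simp add: trE trF)
qed

lemma conn_VF: "affine_connection A D \<Longrightarrow> X \<in> VF \<Longrightarrow> Y \<in> VF \<Longrightarrow> D X Y \<in> VF"
  and conn_add_left: "affine_connection A D \<Longrightarrow> X \<in> VF \<Longrightarrow> Y \<in> VF \<Longrightarrow> Z \<in> VF \<Longrightarrow> D (X + Y) Z = D X Z + D Y Z"
  and conn_vscale_left: "affine_connection A D \<Longrightarrow> f \<in> SF \<Longrightarrow> X \<in> VF \<Longrightarrow> Y \<in> VF \<Longrightarrow> D (f \<odot> X) Y = f \<odot> D X Y"
  and conn_add_right: "affine_connection A D \<Longrightarrow> X \<in> VF \<Longrightarrow> Y \<in> VF \<Longrightarrow> Z \<in> VF \<Longrightarrow> D X (Y + Z) = D X Y + D X Z"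
  and conn_vscale_right: "affine_connection A D \<Longrightarrow> f \<in> SF \<Longrightarrow> X \<in> VF \<Longrightarrow> Y \<in> VF \<Longrightarrow> D X (f \<odot> Y) = X f \<odot> Y + f \<odot> D X Y"
  by (auto simp: affine_connection_def tensor_11_def)

lemma conn_diff_left:
  assumes D: "affine_connection A D" and "X \<in> VF" "Y \<in> VF" "Z \<in> VF"
  shows "D (X - Y) Z = D X Z - D Y Z"
  using conn_add_left[OF D VF_diff[OF assms(2,3)] assms(3,4)] by (simp add: eq_diff_eq)

lemma conn_diff_right:
  assumes D: "affine_connection A D" and "X \<in> VF" "Y \<in> VF" "Z \<in> VF"
  shows "D X (Y - Z) = D X Y - D X Z"
  using conn_add_right[OF D assms(2) VF_diff[OF assms(3,4)] assms(4)] by (simp add: eq_diff_eq)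

lemma lie_bracket_add_left:
  "X \<in> VF \<Longrightarrow> Y \<in> VF \<Longrightarrow> Z \<in> VF \<Longrightarrow> lie_bracket (X + Y) Z = lie_bracket X Z + lie_bracket Y Z"
proof
  fix f assume V: "X \<in> VF" "Y \<in> VF" "Z \<in> VF"
  have "Z (X f + Y f) = Z (X f) + Z (Y f)"
    using V by (cases "f \<in> SF") (simp_all add: VF_add_fun[of Z] VF_SF[of X] VF_SF[of Y]
        VF_nonsmooth[of X] VF_nonsmooth[of Y] VF_0_fun[of Z])
  then show "lie_bracket (X + Y) Z f = (lie_bracket X Z + lie_bracket Y Z) f"
    by (simp add: lie_bracket_def)
qed

lemma lie_bracket_vscale_left:
  assumes f: "f \<in> SF" and X: "X \<in> VF" and Z: "Z \<in> VF"
  shows "lie_bracket (f \<odot> X) Z = f \<odot> lie_bracket X Z - Z f \<odot> X"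
proof
  fix h
  have "Z (f * X h) = f * Z (X h) + X h * Z f"
    using f VF_mult_fun[OF Z f] X by (cases "h \<in> SF")
      (simp_all add: VF_SF[OF X] VF_nonsmooth[OF X] VF_0_fun[OF Z])
  then show "lie_bracket (f \<odot> X) Z h = (f \<odot> lie_bracket X Z - Z f \<odot> X) h"
    by (simp add: lie_bracket_def vscale_def algebra_simps)
qed

text \<open>
  The Ricci tensor is a trace over the first curvature argument; this linearity is what permits
  a change of frame, and of metric, in that trace.
\<close>

lemma tensor_11_curvature:
  assumes D: "affine_connection A D" and X: "X \<in> VF" and Y: "Y \<in> VF"
  shows "tensor_11 A (\<lambda>Z. curvature D Z X Y)"
  unfolding tensor_11_def
proof (intro conjI ballI)
  note V = conn_VF[OF D]
  fix Z assume Z: "Z \<in> VF"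
  show "curvature D Z X Y \<in> VF" unfolding curvature_def using V X Y Z by simp
  show "curvature D (Z + W) X Y = curvature D Z X Y + curvature D W X Y" if W: "W \<in> VF" for W
    unfolding curvature_def using V X Y Z W
    by (simp add: conn_add_left[OF D] conn_add_right[OF D] lie_bracket_add_left)
  show "curvature D (f \<odot> Z) X Y = f \<odot> curvature D Z X Y" if f: "f \<in> SF" for f
    unfolding curvature_def using V X Y Z f VF_SF[OF X f]
    by (simp add: conn_vscale_left[OF D] conn_vscale_right[OF D] conn_diff_left[OF D] lie_bracket_vscale_left)
      (simp add: vscale_def fun_eq_iff algebra_simps)
qed

end

section \<open>Kenmotsu manifolds\<close>

context smooth_manifold
begin

lemma VF_eq_0I: "X \<in> VF \<Longrightarrow> (\<And>p. vanishes_at X p) \<Longrightarrow> X = 0"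
  by (simp add: vanishes_at_def fun_eq_iff)

lemma metric_eq_0D:
  assumes "riemannian_metric A g" "X \<in> VF" "g X X = 0"
  shows "X = 0"
  using metric_pos[OF assms(1,2)] assms(3) by (intro VF_eq_0I assms) (metis less_irrefl zero_fun_apply)

lemma conn_0_right:
  assumes D: "affine_connection A D" and X: "X \<in> VF"
  shows "D X 0 = 0"
  using conn_add_right[OF D X VF_0 VF_0] by simp

end

locale kenmotsu_manifold = smooth_manifold A
  for A :: "('a::{t2_space, second_countable_topology}, 'e::euclidean_space) chart set" +
  fixes \<phi> \<xi> \<eta> g D
  assumes kenmotsu: "kenmotsu A \<phi> \<xi> \<eta> g D"
begin

lemma metric: "riemannian_metric A g"
  and \<phi>_tensor: "tensor_11 A \<phi>"
  and \<xi>_VF [simp, intro]: "\<xi> \<in> VF"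
  and \<eta>_form: "one_form A \<eta>"
  and \<phi>_\<phi>: "X \<in> VF \<Longrightarrow> \<phi> (\<phi> X) = - X + \<eta> X \<odot> \<xi>"
  and \<eta>_\<xi> [simp]: "\<eta> \<xi> = 1"
  and \<eta>_eq: "X \<in> VF \<Longrightarrow> \<eta> X = g \<xi> X"
  and g_\<phi>_\<phi>: "X \<in> VF \<Longrightarrow> Y \<in> VF \<Longrightarrow> g (\<phi> X) (\<phi> Y) = g X Y - \<eta> X * \<eta> Y"
  and levi_civita: "levi_civita A g D"
  and D_\<phi>: "X \<in> VF \<Longrightarrow> Y \<in> VF \<Longrightarrow> D X (\<phi> Y) - \<phi> (D X Y) = g (\<phi> X) Y \<odot> \<xi> - \<eta> Y \<odot> \<phi> X"
  using kenmotsu by (simp_all add: kenmotsu_def almost_contact_metric_def)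

lemma conn: "affine_connection A D"
  and torsion_free: "X \<in> VF \<Longrightarrow> Y \<in> VF \<Longrightarrow> lie_bracket X Y = D X Y - D Y X"
  and metric_compatible: "X \<in> VF \<Longrightarrow> Y \<in> VF \<Longrightarrow> Z \<in> VF \<Longrightarrow> X (g Y Z) = g (D X Y) Z + g Y (D X Z)"
  using levi_civita unfolding levi_civita_def by (metis, metis, blast)

lemma D_VF [simp, intro]: "X \<in> VF \<Longrightarrow> Y \<in> VF \<Longrightarrow> D X Y \<in> VF"
  by (rule conn_VF[OF conn])

lemma g_form_left: "Y \<in> VF \<Longrightarrow> one_form A (\<lambda>X. g X Y)"
  and g_form_right: "X \<in> VF \<Longrightarrow> one_form A (g X)"
  using metric_tensor[OF metric] by (simp_all add: tensor_02_def)

lemmas g_sym = metric_sym[OF metric]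

lemma g_SF [simp, intro]: "X \<in> VF \<Longrightarrow> Y \<in> VF \<Longrightarrow> g X Y \<in> SF"
  and \<eta>_SF [simp, intro]: "X \<in> VF \<Longrightarrow> \<eta> X \<in> SF"
  by (auto intro: one_form_SF[OF g_form_right] one_form_SF[OF \<eta>_form])

lemma \<phi>_VF [simp, intro]: "X \<in> VF \<Longrightarrow> \<phi> X \<in> VF"
  and \<phi>_add: "X \<in> VF \<Longrightarrow> Y \<in> VF \<Longrightarrow> \<phi> (X + Y) = \<phi> X + \<phi> Y"
  and \<phi>_vscale: "f \<in> SF \<Longrightarrow> X \<in> VF \<Longrightarrow> \<phi> (f \<odot> X) = f \<odot> \<phi> X"
  using \<phi>_tensor by (simp_all add: tensor_11_def)

lemma g_\<xi>_right: "X \<in> VF \<Longrightarrow> g X \<xi> = \<eta> X"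
  using \<eta>_eq g_sym by simp

lemma g_\<xi>_left: "X \<in> VF \<Longrightarrow> g \<xi> X = \<eta> X"
  using \<eta>_eq by simp

lemma \<phi>_\<xi>: "\<phi> \<xi> = 0"
  by (rule metric_eq_0D[OF metric]) (simp_all add: g_\<phi>_\<phi> g_\<xi>_right)

lemma \<phi>_uminus: "X \<in> VF \<Longrightarrow> \<phi> (- X) = - \<phi> X"
proof -
  assume X: "X \<in> VF"
  have "\<phi> 0 = 0" using \<phi>_add[OF VF_0 VF_0] by simp
  then show ?thesis using \<phi>_add[OF X VF_uminus[OF X]] by (simp add: eq_neg_iff_add_eq_0 add.commute)
qed

lemma \<eta>_\<phi>:
  assumes X: "X \<in> VF"
  shows "\<eta> (\<phi> X) = 0"
proof -
  have "\<phi> (\<phi> (\<phi> X)) = - \<phi> X + \<eta> (\<phi> X) \<odot> \<xi>" using X by (intro \<phi>_\<phi>) simp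
  moreover have "\<phi> (\<phi> (\<phi> X)) = \<phi> (- X) + \<phi> (\<eta> X \<odot> \<xi>)"
    using X by (simp only: \<phi>_\<phi> \<phi>_add VF_uminus VF_vscale \<eta>_SF \<xi>_VF)
  then have "\<phi> (\<phi> (\<phi> X)) = - \<phi> X" using X by (simp add: \<phi>_uminus \<phi>_vscale \<phi>_\<xi>)
  ultimately have "\<eta> (\<phi> X) \<odot> \<xi> = 0" by simp
  then have "\<eta> (\<eta> (\<phi> X) \<odot> \<xi>) = 0" by (simp add: one_form_0[OF \<eta>_form])
  then show ?thesis using X by (simp add: one_form_vscale[OF \<eta>_form])
qed

lemma \<eta>_D_\<xi>:
  assumes X: "X \<in> VF"
  shows "\<eta> (D X \<xi>) = 0"
proof -
  have "X 1 = \<eta> (D X \<xi>) + \<eta> (D X \<xi>)"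
    using metric_compatible[OF X \<xi>_VF \<xi>_VF] X by (simp add: g_\<xi>_left g_\<xi>_right)
  moreover have "X 1 = 0"
    using VF_const_fun[OF X, of 1] unfolding one_fun_def .
  ultimately show ?thesis by (simp add: fun_eq_iff)
qed

text \<open>
  Put \<open>Y = \<xi>\<close> in the Kenmotsu condition and apply \<open>\<phi>\<close> to remove the outer \<open>\<phi>\<close>; the part along \<open>\<xi>\<close>
  vanishes because \<open>\<xi>\<close> has constant length.
\<close>

lemma D_\<xi>:
  assumes X: "X \<in> VF"
  shows "D X \<xi> = X - \<eta> X \<odot> \<xi>"
proof -
  have "- \<phi> (D X \<xi>) = - \<phi> X"
    using D_\<phi>[OF X \<xi>_VF] X by (simp add: \<phi>_\<xi> conn_0_right[OF conn] g_\<xi>_right \<eta>_\<phi>)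
  then have "\<phi> (\<phi> (D X \<xi>)) = \<phi> (\<phi> X)" by simp
  then have "- D X \<xi> = - X + \<eta> X \<odot> \<xi>" using X by (simp add: \<phi>_\<phi> \<eta>_D_\<xi>)
  from arg_cong[OF this, of uminus] show ?thesis by simp
qed

lemma D_\<xi>_\<xi>: "D \<xi> \<xi> = 0"
  by (simp add: D_\<xi>)

text \<open>
  Since \<open>\<eta> Y = g \<xi> Y\<close>, the formula for \<open>D X \<xi>\<close> determines the covariant derivative of \<open>\<eta>\<close>: it is the
  transverse metric \<open>gT\<close>.
\<close>

lemma X_\<eta>:
  assumes X: "X \<in> VF" and Y: "Y \<in> VF"
  shows "X (\<eta> Y) = g X Y - \<eta> X * \<eta> Y + \<eta> (D X Y)"
proof -
  have "X (\<eta> Y) = g (D X \<xi>) Y + \<eta> (D X Y)"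
    using metric_compatible[OF X \<xi>_VF Y] X Y by (simp add: g_\<xi>_left)
  also have "g (D X \<xi>) Y = g X Y - \<eta> X * \<eta> Y"
    using X Y by (simp add: D_\<xi> one_form_diff[OF g_form_left[OF Y]] one_form_vscale[OF g_form_left[OF Y]] g_\<xi>_left)
  finally show ?thesis .
qed

lemma curvature_\<xi>:
  assumes Z: "Z \<in> VF"
  shows "curvature D Z \<xi> \<xi> = \<eta> Z \<odot> \<xi> - Z"
proof -
  have lb: "lie_bracket Z \<xi> = Z - \<eta> Z \<odot> \<xi> - D \<xi> Z"
    using Z by (simp add: torsion_free D_\<xi>)
  have "\<eta> (lie_bracket Z \<xi>) = - \<eta> (D \<xi> Z)"
    unfolding lb using Z by (simp add: one_form_diff[OF \<eta>_form] one_form_vscale[OF \<eta>_form])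
  then have 1: "D (lie_bracket Z \<xi>) \<xi> = Z - \<eta> Z \<odot> \<xi> - D \<xi> Z - (- \<eta> (D \<xi> Z)) \<odot> \<xi>"
    using Z D_\<xi>[of "lie_bracket Z \<xi>"] by (simp add: lb)
  have "\<xi> (\<eta> Z) = \<eta> (D \<xi> Z)" using X_\<eta>[OF \<xi>_VF Z] Z by (simp add: g_\<xi>_left)
  then have 2: "D \<xi> (D Z \<xi>) = D \<xi> Z - \<eta> (D \<xi> Z) \<odot> \<xi>"
    using Z by (simp add: D_\<xi> conn_diff_right[OF conn] conn_vscale_right[OF conn])
  show ?thesis
    unfolding curvature_def 1 2 D_\<xi>_\<xi> conn_0_right[OF conn Z]
    by (simp add: vscale_def fun_eq_iff algebra_simps)
qed

lemma Ric_\<xi>_\<xi>: "Ric A g D \<xi> \<xi> p = 1 - real DIM('e)"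
proof -
  obtain E where E: "orthonormal_at A g p E"
    and tr: "\<And>B. metric_trace A g B p = (\<Sum>i<DIM('e). B (E i) (E i) p)"
    using metric_trace_frame[OF metric] by blast
  have EV: "E i \<in> VF" and gE: "g (E i) (E i) p = 1" if "i < DIM('e)" for i
    using E that by (auto simp: orthonormal_at_def)
  have "g (curvature D (E i) \<xi> \<xi>) (E i) p = g \<xi> (E i) p * \<eta> (E i) p - 1" if "i < DIM('e)" for i
    using EV[OF that] gE[OF that]
    by (simp add: curvature_\<xi> one_form_diff[OF g_form_left] one_form_vscale[OF g_form_left] g_\<xi>_left)
  then have "Ric A g D \<xi> \<xi> p = (\<Sum>i<DIM('e). g \<xi> (E i) p * \<eta> (E i) p - 1)"
    unfolding Ric_def tr by (intro sum.cong) auto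
  also have "\<dots> = \<eta> \<xi> p - real DIM('e)"
    using orthonormal_expansion[OF metric E \<xi>_VF \<eta>_form] by (simp add: sum_subtractf)
  finally show ?thesis by simp
qed

text \<open>
  The metric on the kernel of \<open>\<eta>\<close>, extended by zero along \<open>\<xi>\<close>.  It equals the covariant derivative
  of \<open>\<eta>\<close> and measures the difference between the two connections.
\<close>

definition gT where "gT X Y = g X Y - \<eta> X * \<eta> Y"

lemma gT_SF [simp, intro]: "X \<in> VF \<Longrightarrow> Y \<in> VF \<Longrightarrow> gT X Y \<in> SF"
  by (auto simp: gT_def)

lemma gT_sym: "X \<in> VF \<Longrightarrow> Y \<in> VF \<Longrightarrow> gT X Y = gT Y X"
  by (simp add: gT_def g_sym[of X Y] mult.commute)

lemma gT_form_left: "Y \<in> VF \<Longrightarrow> one_form A (\<lambda>X. gT X Y)"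
  unfolding one_form_def gT_def
  using one_form_add[OF g_form_left] one_form_vscale[OF g_form_left] one_form_add[OF \<eta>_form] one_form_vscale[OF \<eta>_form]
  by (auto simp: algebra_simps)

lemma gT_form_right: "X \<in> VF \<Longrightarrow> one_form A (gT X)"
  unfolding one_form_def gT_def
  using one_form_add[OF g_form_right] one_form_vscale[OF g_form_right] one_form_add[OF \<eta>_form] one_form_vscale[OF \<eta>_form]
  by (auto simp: algebra_simps)

lemma gT_\<xi>_right: "X \<in> VF \<Longrightarrow> gT X \<xi> = 0"
  by (simp add: gT_def g_\<xi>_right)

lemma X_gT:
  assumes "X \<in> VF" "Y \<in> VF" "Z \<in> VF"
  shows "X (gT Y Z) = gT (D X Y) Z + gT Y (D X Z) - gT X Y * \<eta> Z - gT X Z * \<eta> Y"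
  using assms(2,3)
  by (simp add: gT_def VF_diff_fun[OF assms(1)] VF_mult_fun[OF assms(1)] metric_compatible[OF assms]
      X_\<eta>[OF assms(1,2)] X_\<eta>[OF assms(1,3)])
    (simp add: fun_eq_iff algebra_simps)

end

section \<open>The deformed connection and its Ricci tensor\<close>

locale D_homothetic_kenmotsu = kenmotsu_manifold A \<phi> \<xi> \<eta> g D
  for A :: "('a::{t2_space, second_countable_topology}, 'e::euclidean_space) chart set"
    and \<phi> \<xi> \<eta> g D +
  fixes a :: real and g' D'
  assumes a_pos: "a > 0"
    and g'_def: "g' = (\<lambda>X Y p. a * g X Y p + a * (a - 1) * \<eta> X p * \<eta> Y p)"
    and metric': "riemannian_metric A g'"
    and levi_civita': "levi_civita A g' D'"
begin

lemma conn': "affine_connection A D'"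
  and torsion_free': "X \<in> VF \<Longrightarrow> Y \<in> VF \<Longrightarrow> lie_bracket X Y = D' X Y - D' Y X"
  and metric_compatible': "X \<in> VF \<Longrightarrow> Y \<in> VF \<Longrightarrow> Z \<in> VF \<Longrightarrow> X (g' Y Z) = g' (D' X Y) Z + g' Y (D' X Z)"
  using levi_civita' unfolding levi_civita_def by (metis, metis, blast)

lemma D'_VF [simp, intro]: "X \<in> VF \<Longrightarrow> Y \<in> VF \<Longrightarrow> D' X Y \<in> VF"
  by (rule conn_VF[OF conn'])

lemma g'_form_left: "Y \<in> VF \<Longrightarrow> one_form A (\<lambda>X. g' X Y)"
  and g'_form_right: "X \<in> VF \<Longrightarrow> one_form A (g' X)"
  using metric_tensor[OF metric'] by (simp_all add: tensor_02_def)

lemmas g'_sym = metric_sym[OF metric']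

lemma g'_eq: "g' X Y = (\<lambda>_. a) * g X Y + (\<lambda>_. a * (a - 1)) * (\<eta> X * \<eta> Y)"
  by (simp add: g'_def fun_eq_iff)

lemma g'_\<xi>_left: "X \<in> VF \<Longrightarrow> g' \<xi> X = (\<lambda>_. a\<^sup>2) * \<eta> X"
  by (simp add: g'_def g_\<xi>_left fun_eq_iff algebra_simps power2_eq_square)

text \<open>
  The failure of the original connection to be metric for \<open>g'\<close> comes from differentiating \<open>\<eta> \<otimes> \<eta>\<close>.
\<close>

lemma X_g':
  assumes "X \<in> VF" "Y \<in> VF" "Z \<in> VF"
  shows "X (g' Y Z) = g' (D X Y) Z + g' Y (D X Z) + (\<lambda>_. a * (a - 1)) * (gT X Y * \<eta> Z + gT X Z * \<eta> Y)"
  using assms(2,3) unfolding g'_eq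
  by (simp add: VF_add_fun[OF assms(1)] VF_mult_fun[OF assms(1)] VF_const_fun[OF assms(1)] metric_compatible[OF assms]
      X_\<eta>[OF assms(1,2)] X_\<eta>[OF assms(1,3)])
    (simp add: fun_eq_iff gT_def algebra_simps)

definition c where "c = (a - 1) / a"

lemma a2_c: "a\<^sup>2 * c = a * (a - 1)"
  using a_pos by (simp add: c_def power2_eq_square)

text \<open>
  The difference \<open>S\<close> of the two sides is symmetric in \<open>X, Y\<close> because both connections are
  torsion-free, and \<open>g' (S X Y) Z\<close> is skew in \<open>Y, Z\<close> by metricity.  A trilinear form with both
  properties is zero, by applying them alternately.
\<close>

lemma D'_eq:
  assumes X: "X \<in> VF" and Y: "Y \<in> VF"
  shows "D' X Y = D X Y + ((\<lambda>_. c) * gT X Y) \<odot> \<xi>"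
proof -
  define S where "S X Y = D' X Y - (D X Y + ((\<lambda>_. c) * gT X Y) \<odot> \<xi>)" for X Y
  have SV: "S X Y \<in> VF" if "X \<in> VF" "Y \<in> VF" for X Y
    using that unfolding S_def by (intro VF_diff VF_add VF_vscale SF_mult SF_const) auto
  have sym: "S X Y = S Y X" if "X \<in> VF" "Y \<in> VF" for X Y
  proof -
    have "D' X Y - D' Y X = D X Y - D Y X" using torsion_free torsion_free' that by simp
    then show ?thesis using gT_sym[OF that] by (simp add: S_def algebra_simps)
  qed
  have g'S: "g' (S X Y) Z = g' (D' X Y) Z - g' (D X Y) Z - (\<lambda>_. a * (a - 1)) * (gT X Y * \<eta> Z)"
    if "X \<in> VF" "Y \<in> VF" "Z \<in> VF" for X Y Z
  proof -
    have "g' (((\<lambda>_. c) * gT X Y) \<odot> \<xi>) Z = (\<lambda>_. c) * gT X Y * ((\<lambda>_. a\<^sup>2) * \<eta> Z)"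
      using that by (simp add: one_form_vscale[OF g'_form_left] g'_\<xi>_left)
    also have "\<dots> = (\<lambda>_. a * (a - 1)) * (gT X Y * \<eta> Z)"
      by (simp add: fun_eq_iff a2_c[symmetric])
    finally show ?thesis using that
      by (simp add: S_def one_form_diff[OF g'_form_left] one_form_add[OF g'_form_left])
  qed
  have skew: "g' (S X Y) Z = - g' (S X Z) Y" if V: "X \<in> VF" "Y \<in> VF" "Z \<in> VF" for X Y Z
  proof -
    have "g' (D' X Y) Z + g' (D' X Z) Y
        = g' (D X Y) Z + g' (D X Z) Y + (\<lambda>_. a * (a - 1)) * (gT X Y * \<eta> Z + gT X Z * \<eta> Y)"
      using metric_compatible'[OF V] X_g'[OF V] g'_sym[OF V(2) D'_VF[OF V(1,3)]]
        g'_sym[OF V(2) D_VF[OF V(1,3)]] by simp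
    then show ?thesis using V by (simp add: g'S) (simp add: algebra_simps)
  qed
  have "g' (S X Y) Z = 0" if Z: "Z \<in> VF" for Z
  proof -
    have "g' (S X Y) Z = - g' (S X Z) Y" by (rule skew[OF X Y Z])
    also have "\<dots> = - g' (S Z X) Y" by (simp only: sym[OF X Z])
    also have "\<dots> = g' (S Z Y) X" by (simp only: skew[OF Z X Y] minus_minus)
    also have "\<dots> = g' (S Y Z) X" by (simp only: sym[OF Y Z])
    also have "\<dots> = - g' (S Y X) Z" by (rule skew[OF Y Z X])
    also have "\<dots> = - g' (S X Y) Z" by (simp only: sym[OF X Y])
    finally show ?thesis by (simp add: fun_eq_iff)
  qed
  then have "g' (S X Y) (S X Y) = 0" using SV[OF X Y] by blast
  from metric_eq_0D[of g' "S X Y", OF metric' SV[OF X Y] this]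
  show ?thesis by (simp add: S_def)
qed

text \<open>
  The change of connection adds no term along \<open>\<xi>\<close>: the derivative of \<open>gT\<close> cancels against the
  \<open>\<xi>\<close>-components of \<open>D Z \<xi>\<close> and \<open>D X \<xi>\<close>.  No term quadratic in \<open>c\<close> arises, since \<open>gT\<close> annihilates \<open>\<xi>\<close>.
\<close>

lemma curvature'_eq:
  assumes Z: "Z \<in> VF" and X: "X \<in> VF" and Y: "Y \<in> VF"
  shows "curvature D' Z X Y
    = curvature D Z X Y + ((\<lambda>_. c) * gT X Y) \<odot> Z - ((\<lambda>_. c) * gT Z Y) \<odot> X"
proof -
  have second: "D' Z (D' X Y) = D Z (D X Y) + ((\<lambda>_. c) * (Z (gT X Y) + gT Z (D X Y))) \<odot> \<xi>
      + ((\<lambda>_. c) * gT X Y) \<odot> (Z - \<eta> Z \<odot> \<xi>)" if Z: "Z \<in> VF" and X: "X \<in> VF" for X Z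
  proof -
    let ?f = "(\<lambda>_. c) * gT X Y"
    have f: "?f \<in> SF" using X Y by auto
    have "gT Z (D' X Y) = gT Z (D X Y)"
      using X Y Z f by (simp add: D'_eq one_form_add[OF gT_form_right] one_form_vscale[OF gT_form_right] gT_\<xi>_right)
    then have "D' Z (D' X Y) = D Z (D X Y + ?f \<odot> \<xi>) + ((\<lambda>_. c) * gT Z (D X Y)) \<odot> \<xi>"
      using D'_eq[OF Z D'_VF[OF X Y]] by (simp add: D'_eq[OF X Y])
    also have "D Z (D X Y + ?f \<odot> \<xi>) = D Z (D X Y) + (((\<lambda>_. c) * Z (gT X Y)) \<odot> \<xi> + ?f \<odot> (Z - \<eta> Z \<odot> \<xi>))"
      using X Y Z f by (simp add: conn_add_right[OF conn] conn_vscale_right[OF conn] D_\<xi> VF_scale_fun[OF Z])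
    finally show ?thesis by (simp add: vscale_def fun_eq_iff algebra_simps)
  qed
  have lb: "gT (lie_bracket Z X) Y = gT (D Z X) Y - gT (D X Z) Y"
    using X Y Z by (simp add: torsion_free one_form_diff[OF gT_form_left])
  have lbV: "lie_bracket Z X \<in> VF" using X Z by simp
  show ?thesis
    unfolding curvature_def second[OF Z X] second[OF X Z] D'_eq[OF lbV Y] lb X_gT[OF Z X Y] X_gT[OF X Z Y]
      gT_sym[OF X Z]
    by (simp add: vscale_def fun_eq_iff algebra_simps)
qed

text \<open>
  As a trace of a \<open>(1,1)\<close>-tensor, \<open>Ric'\<close> may be computed in a \<open>g\<close>-orthonormal frame.
\<close>

lemma Ric'_eq:
  assumes X: "X \<in> VF" and Y: "Y \<in> VF"
  shows "Ric A g' D' X Y p = Ric A g D X Y p + (real DIM('e) - 1) * c * gT X Y p"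
proof -
  obtain E where E: "orthonormal_at A g p E"
    and tr: "\<And>B. metric_trace A g B p = (\<Sum>i<DIM('e). B (E i) (E i) p)"
    using metric_trace_frame[OF metric] by blast
  have EV: "E i \<in> VF" and gE: "g (E i) (E i) p = 1" if "i < DIM('e)" for i
    using E that by (auto simp: orthonormal_at_def)
  have CV: "curvature D Z X Y \<in> VF" if "Z \<in> VF" for Z
    using tensor_11_curvature[OF conn X Y] that by (simp add: tensor_11_def)
  have "Ric A g' D' X Y p = metric_trace A g (\<lambda>Z W. g (curvature D' Z X Y) W) p"
    unfolding Ric_def
    by (rule trace_metric_independent[OF metric' metric tensor_11_curvature[OF conn' X Y]])
  also have "\<dots> = (\<Sum>i<DIM('e). g (curvature D (E i) X Y) (E i) p + c * gT X Y p
      - c * (g X (E i) p * gT (E i) Y p))"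
    unfolding tr
  proof (rule sum.cong)
    fix i assume "i \<in> {..<DIM('e)}"
    then have i: "E i \<in> VF" "g (E i) (E i) p = 1" using EV gE by auto
    then show "g (curvature D' (E i) X Y) (E i) p
        = g (curvature D (E i) X Y) (E i) p + c * gT X Y p - c * (g X (E i) p * gT (E i) Y p)"
      using X Y CV
      by (simp add: curvature'_eq one_form_diff[OF g_form_left] one_form_add[OF g_form_left]
          one_form_vscale[OF g_form_left])
  qed simp
  also have "\<dots> = Ric A g D X Y p + real DIM('e) * c * gT X Y p
      - c * (\<Sum>i<DIM('e). g X (E i) p * gT (E i) Y p)"
    unfolding Ric_def tr by (simp add: sum.distrib sum_subtractf sum_distrib_left)
  also have "(\<Sum>i<DIM('e). g X (E i) p * gT (E i) Y p) = gT X Y p"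
    using orthonormal_expansion[OF metric E X gT_form_left[OF Y]] by simp
  finally show ?thesis by (simp add: algebra_simps)
qed

lemma lie_derivative_g':
  assumes V: "V \<in> VF" and X: "X \<in> VF" and Y: "Y \<in> VF"
  shows "lie_derivative_02 V g' X Y = g' (D' X V) Y + g' X (D' Y V)"
  using assms
  by (simp add: lie_derivative_02_def torsion_free' metric_compatible'[OF V X Y]
      one_form_diff[OF g'_form_left] one_form_diff[OF g'_form_right])

lemma g'_D'_V:
  assumes V: "V \<in> VF" and X: "X \<in> VF" and Y: "Y \<in> VF"
  shows "g' (D' X V) Y p = a * g (D X V) Y p
    + a * (a - 1) * (\<eta> (D X V) p + g X V p - \<eta> X p * \<eta> V p) * \<eta> Y p"
proof -
  have "g' (D' X V) Y p = g' (D X V) Y p + (a\<^sup>2 * c) * gT X V p * \<eta> Y p"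
    using assms by (simp add: D'_eq one_form_add[OF g'_form_left] one_form_vscale[OF g'_form_left] g'_\<xi>_left)
  then show ?thesis unfolding a2_c by (simp add: g'_def gT_def algebra_simps)
qed

end

section \<open>Almost Ricci solitons of the deformed metric\<close>

context D_homothetic_kenmotsu
begin

text \<open>
  Evaluation at \<open>(\<xi>, \<xi>)\<close> isolates the soliton function, since there \<open>gT\<close> vanishes and \<open>Ric'\<close> is a
  constant.
\<close>

lemma soliton_function_eq:
  assumes V: "V \<in> VF"
    and soliton: "1/2 * lie_derivative_02 V g' \<xi> \<xi> p + Ric A g' D' \<xi> \<xi> p = lam p * g' \<xi> \<xi> p"
  shows "lam p = \<xi> (\<eta> V) p - (real DIM('e) - 1) / a\<^sup>2"
proof -
  have "\<xi> (\<eta> V) = \<eta> (D \<xi> V)"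
    using X_\<eta>[OF \<xi>_VF V] V by (simp add: g_\<xi>_left)
  then have "g' (D' \<xi> V) \<xi> p = a\<^sup>2 * \<xi> (\<eta> V) p"
    using g'_D'_V[OF V \<xi>_VF \<xi>_VF] V
    by (simp add: g_\<xi>_left g_\<xi>_right power2_eq_square algebra_simps)
  then have "1/2 * lie_derivative_02 V g' \<xi> \<xi> p = a\<^sup>2 * \<xi> (\<eta> V) p"
    using lie_derivative_g'[OF V \<xi>_VF \<xi>_VF] g'_sym[OF \<xi>_VF D'_VF[OF \<xi>_VF V]] by simp
  moreover have "Ric A g' D' \<xi> \<xi> p = 1 - real DIM('e)"
    by (simp add: Ric'_eq Ric_\<xi>_\<xi> gT_\<xi>_right)
  moreover have "g' \<xi> \<xi> p = a\<^sup>2" by (simp add: g'_\<xi>_left)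
  ultimately have "a\<^sup>2 * \<xi> (\<eta> V) p + (1 - real DIM('e)) = lam p * a\<^sup>2"
    using soliton by metis
  then show ?thesis using a_pos by (simp add: field_simps)
qed

text \<open>
  The soliton function and \<open>Ric'\<close> each contribute a multiple of \<open>DIM('e) - 1\<close>; by the choice of \<open>c\<close> the
  \<open>\<eta> \<otimes> \<eta>\<close> parts of the two cancel, and \<open>(DIM('e) - 1) g\<close> remains.
\<close>

lemma soliton_Ric_eq:
  assumes V: "V \<in> VF" and X: "X \<in> VF" and Y: "Y \<in> VF"
    and soliton: "1/2 * lie_derivative_02 V g' X Y p + Ric A g' D' X Y p = lam p * g' X Y p"
    and lam: "lam p = \<xi> (\<eta> V) p - (real DIM('e) - 1) / a\<^sup>2"
  shows "Ric A g D X Y p =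
         (a * \<xi> (\<eta> V) p - (real DIM('e) - 1)) * g X Y p
         + a * (a - 1) * \<xi> (\<eta> V) p * \<eta> X p * \<eta> Y p
         - a / 2 * (g (D X V) Y p + g (D Y V) X p)
         - a * (a - 1) / 2 *
             (\<eta> X p * (\<eta> (D Y V) p + g Y V p) + \<eta> Y p * (\<eta> (D X V) p + g X V p)
              - 2 * \<eta> X p * \<eta> Y p * \<eta> V p)"
proof -
  let ?d = "real DIM('e) - 1"
  have "lie_derivative_02 V g' X Y p = g' (D' X V) Y p + g' (D' Y V) X p"
    using lie_derivative_g'[OF V X Y] g'_sym[OF X D'_VF[OF Y V]] by simp
  then have Lie: "lie_derivative_02 V g' X Y p = a * (g (D X V) Y p + g (D Y V) X p)
      + a * (a - 1) * (\<eta> X p * (\<eta> (D Y V) p + g Y V p) + \<eta> Y p * (\<eta> (D X V) p + g X V p)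
              - 2 * \<eta> X p * \<eta> Y p * \<eta> V p)"
    unfolding g'_D'_V[OF V X Y] g'_D'_V[OF V Y X] by (simp add: algebra_simps)
  have g': "g' X Y p = a * g X Y p + a * (a - 1) * \<eta> X p * \<eta> Y p"
    by (simp add: g'_def)
  have "?d / a\<^sup>2 * g' X Y p + ?d * c * gT X Y p = ?d * g X Y p"
    using a_pos unfolding g' c_def gT_def by (simp add: field_simps power2_eq_square)
  then have "Ric A g D X Y p = \<xi> (\<eta> V) p * g' X Y p - ?d * g X Y p - 1/2 * lie_derivative_02 V g' X Y p"
    using soliton Ric'_eq[OF X Y] unfolding lam by (simp add: algebra_simps)
  then show ?thesis unfolding Lie g' by (simp add: algebra_simps add_divide_distrib diff_divide_distrib)
qed

text \<open>
  In the trace the terms with \<open>\<eta>\<close> become \<open>a (a - 1) \<xi>(\<eta> V)\<close> and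
  \<open>a (a - 1) (\<eta>(D \<xi> V) + \<eta> V - \<eta> V)\<close>, which agree because \<open>\<xi>(\<eta> V) = \<eta>(D \<xi> V)\<close>.
\<close>

lemma soliton_scal_eq:
  assumes V: "V \<in> VF" and div: "divergence A g D V p = 0"
    and Ric: "\<And>X Y. X \<in> VF \<Longrightarrow> Y \<in> VF \<Longrightarrow> Ric A g D X Y p =
         (a * \<xi> (\<eta> V) p - (real DIM('e) - 1)) * g X Y p
         + a * (a - 1) * \<xi> (\<eta> V) p * \<eta> X p * \<eta> Y p
         - a / 2 * (g (D X V) Y p + g (D Y V) X p)
         - a * (a - 1) / 2 *
             (\<eta> X p * (\<eta> (D Y V) p + g Y V p) + \<eta> Y p * (\<eta> (D X V) p + g X V p)
              - 2 * \<eta> X p * \<eta> Y p * \<eta> V p)"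
  shows "scal A g D p = real DIM('e) * (a * \<xi> (\<eta> V) p - (real DIM('e) - 1))"
proof -
  let ?L = "\<xi> (\<eta> V) p" and ?d = "real DIM('e) - 1"
  obtain E where E: "orthonormal_at A g p E"
    and tr: "\<And>B. metric_trace A g B p = (\<Sum>i<DIM('e). B (E i) (E i) p)"
    using metric_trace_frame[OF metric] by blast
  have EV: "E i \<in> VF" and gE: "g (E i) (E i) p = 1" if "i < DIM('e)" for i
    using E that by (auto simp: orthonormal_at_def)
  have trace_\<eta>: "(\<Sum>i<DIM('e). \<eta> (E i) p * \<theta> (E i) p) = \<theta> \<xi> p" if "one_form A \<theta>" for \<theta>
    using orthonormal_expansion[OF metric E \<xi>_VF that] EV by (simp add: g_\<xi>_left)
  have \<theta>: "one_form A (\<lambda>X. \<eta> (D X V))"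
    using conn V by (intro tensor_11_one_form[OF _ \<eta>_form]) (simp add: affine_connection_def)
  have \<xi>L: "\<eta> (D \<xi> V) p = ?L"
    using X_\<eta>[OF \<xi>_VF V] V by (simp add: g_\<xi>_left)
  have "scal A g D p = (\<Sum>i<DIM('e). (a * ?L - ?d) + a * (a - 1) * ?L * (\<eta> (E i) p * \<eta> (E i) p)
      - a * g (D (E i) V) (E i) p
      - a * (a - 1) * (\<eta> (E i) p * \<eta> (D (E i) V) p + \<eta> (E i) p * g (E i) V p
          - \<eta> V p * (\<eta> (E i) p * \<eta> (E i) p)))"
    unfolding scal_def tr
  proof (rule sum.cong)
    fix i assume "i \<in> {..<DIM('e)}"
    then have "E i \<in> VF" "g (E i) (E i) p = 1" using EV gE by auto
    then show "Ric A g D (E i) (E i) p = (a * ?L - ?d) + a * (a - 1) * ?L * (\<eta> (E i) p * \<eta> (E i) p)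
      - a * g (D (E i) V) (E i) p
      - a * (a - 1) * (\<eta> (E i) p * \<eta> (D (E i) V) p + \<eta> (E i) p * g (E i) V p
          - \<eta> V p * (\<eta> (E i) p * \<eta> (E i) p))"
      by (simp add: Ric field_simps)
  qed simp
  also have "\<dots> = real DIM('e) * (a * ?L - ?d) + a * (a - 1) * ?L * (\<Sum>i<DIM('e). \<eta> (E i) p * \<eta> (E i) p)
      - a * (\<Sum>i<DIM('e). g (D (E i) V) (E i) p)
      - a * (a - 1) * ((\<Sum>i<DIM('e). \<eta> (E i) p * \<eta> (D (E i) V) p) + (\<Sum>i<DIM('e). \<eta> (E i) p * g (E i) V p)
          - \<eta> V p * (\<Sum>i<DIM('e). \<eta> (E i) p * \<eta> (E i) p))"
    by (simp only: sum.distrib sum_subtractf flip: sum_distrib_left) (simp add: algebra_simps)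
  also have "(\<Sum>i<DIM('e). g (D (E i) V) (E i) p) = 0"
    using div by (simp add: divergence_def tr)
  finally show ?thesis
    using trace_\<eta>[OF \<eta>_form] trace_\<eta>[OF \<theta>] trace_\<eta>[OF g_form_left[OF V]] V
    by (simp add: \<xi>L g_\<xi>_left)
qed

end

theorem theorem4p4:
  fixes A :: "('a::{t2_space, second_countable_topology}, 'e::euclidean_space) chart set"
    and n :: nat and a :: real
    and \<phi> \<phi>' :: "'a vfield \<Rightarrow> 'a vfield" and \<xi> \<xi>' V :: "'a vfield"
    and \<eta> \<eta>' :: "'a vfield \<Rightarrow> 'a \<Rightarrow> real"
    and g g' :: "'a vfield \<Rightarrow> 'a vfield \<Rightarrow> 'a \<Rightarrow> real"
    and D D' :: "'a vfield \<Rightarrow> 'a vfield \<Rightarrow> 'a vfield"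
    and lam :: "'a \<Rightarrow> real"
  assumes "smooth_atlas A"
    and "n \<ge> 1" and "DIM('e) = 2 * n + 1"
    and "kenmotsu A \<phi> \<xi> \<eta> g D"
    and "a > 0"
    and "(\<phi>', \<xi>', \<eta>', g') = D_homothetic a (\<phi>, \<xi>, \<eta>, g)"
    and "almost_ricci_soliton A g' D' V lam"
    and "solenoidal A g D V"
  shows "(\<forall>p. lam p = \<xi> (\<eta> V) p - 2 * real n / a\<^sup>2) \<and>
    (\<forall>X\<in>vector_fields A. \<forall>Y\<in>vector_fields A. \<forall>p.
       Ric A g D X Y p =
         (a * \<xi> (\<eta> V) p - 2 * real n) * g X Y p
         + a * (a - 1) * \<xi> (\<eta> V) p * \<eta> X p * \<eta> Y p
         - a / 2 * (g (D X V) Y p + g (D Y V) X p)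
         - a * (a - 1) / 2 *
             (\<eta> X p * (\<eta> (D Y V) p + g Y V p) + \<eta> Y p * (\<eta> (D X V) p + g X V p)
              - 2 * \<eta> X p * \<eta> Y p * \<eta> V p)) \<and>
    (\<forall>p. scal A g D p = (2 * real n + 1) * (a * \<xi> (\<eta> V) p - 2 * real n))"
proof -
  have V: "V \<in> vector_fields A"
    and soliton: "\<And>X Y p. X \<in> vector_fields A \<Longrightarrow> Y \<in> vector_fields A \<Longrightarrow>
        1/2 * lie_derivative_02 V g' X Y p + Ric A g' D' X Y p = lam p * g' X Y p"
    using \<open>almost_ricci_soliton A g' D' V lam\<close> by (simp_all add: almost_ricci_soliton_def)
  interpret D_homothetic_kenmotsu A \<phi> \<xi> \<eta> g D a g' D'
    using assms by unfold_locales (auto simp: D_homothetic_def almost_ricci_soliton_def)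
  have dim: "real DIM('e) - 1 = 2 * real n" "real DIM('e) = 2 * real n + 1"
    using \<open>DIM('e) = 2 * n + 1\<close> by simp_all
  have lam: "lam p = \<xi> (\<eta> V) p - (real DIM('e) - 1) / a\<^sup>2" for p
    by (rule soliton_function_eq[OF V soliton]) simp_all
  note Ric = soliton_Ric_eq[where lam = lam, OF V _ _ soliton lam]
  have div: "divergence A g D V p = 0" for p
    using \<open>solenoidal A g D V\<close> by (simp add: solenoidal_def)
  have scal: "scal A g D p = real DIM('e) * (a * \<xi> (\<eta> V) p - (real DIM('e) - 1))" for p
    by (rule soliton_scal_eq[OF V div], rule Ric)
  show ?thesis
    by (intro conjI allI ballI) (use lam Ric scal in \<open>simp_all add: dim\<close>)
qed

end
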